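(* Let $N\ge 2$ and assume that the asset price process $S$ satisfies (A1) and (A2). Consider the withdrawal guarantee with roll-up (see context) with roll-up rate $r_R>-1$, guarantee base $A_t$, and value $\bar V^R_t(w_t,X_t)$. Define, backwards recursively for $t=N-2,\dots,0$, $$\alpha_t:=\alpha_{t+1}\Big[1+\tfrac1{A_{t+2}}C_{t+1}(1+A_{t+2}|A_{t+1})\Big]-\beta_{t+1}P_{t+1}(1+A_{t+2}|A_{t+1})+\int_1^{1+A_{t+2}}P_{t+1}(k|A_{t+1})\,g^R_{t+1}(k)\,dk,$$ $$\beta_t:=\tfrac{\alpha_{t+1}}{A_{t+2}}\Delta^C_{t+1}(1+A_{t+2}|A_{t+1})-\beta_{t+1}\Delta^P_{t+1}(1+A_{t+2}|A_{t+1})+\int_1^{1+A_{t+2}}\Delta^P_{t+1}(k|A_{t+1})\,g^R_{t+1}(k)\,dk,$$ $$g^R_t(k):=\Big(\tfrac{\alpha_{t+1}}{A_{t+2}}-\beta_{t+1}\Big)\Gamma_{t+1}(1+A_{t+2}|k-1)+\int_1^{1+A_{t+2}}\Gamma_{t+1}(k'|k-1)\,g^R_{t+1}(k')\,dk',\quad k\in(1,1+A_{t+1}],$$ with terminal conditions $\alpha_{N-1}=\beta_{N-1}=0$ and $g^R_{N-1}(k)\,dk=\delta_1$ (Dirac measure at $1$, whose mass is included in integrals starting at $1$). Since $A_N=\infty$, for $t=N-2$ all terms containing $\alpha_{N-1}$ or $\beta_{N-1}$ are $0$. Then for $t=0,\dots,N-1$, on $\{\tau>t\}$ with fund value $X_t>0$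 and current withdrawal level $w_t>0$, $$\bar V^R_t(w_t,X_t)=\alpha_t\Big[w_t+\tfrac1{A_{t+1}}C_t\big(w_t(1+A_{t+1})\,\big|\,X_t\big)\Big]-\beta_t\,P_t\big(w_t(1+A_{t+1})\,\big|\,X_t\big)+\int_1^{1+A_{t+1}}P_t(w_tk\,|\,X_t)\,g^R_t(k)\,dk ,$$ where for $t=N-1$ the terms with $\alpha_{N-1},\beta_{N-1}$ vanish.
   Context: Withdrawal times are $0=T_0<T_1<\dots<T_N$ (equidistant). $(S_t)_{t=0,\dots,N}$ is the positive price process of an asset at times $T_t$, under the pricing measure $\mathbb Q$ with filtration $(\mathcal F_t)$; $\mathbb E_t^{\mathbb Q}$ is conditional expectation given $\mathcal F_t$. Interest rates are zero, $S$ is a $\mathbb Q$-martingale, $S_0=1$. $P_t(K|s)=\mathbb E^{\mathbb Q}[(K-S_{t+1})^+|S_t=s]$ and $C_t(K|s)=\mathbb E^{\mathbb Q}[(S_{t+1}-K)^+|S_t=s]$ ($K,s>0$) are put and call values at $T_t$ with maturity $T_{t+1}$; $\Delta^P_t=\partial_sP_t$, $\Delta^C_t=\partial_sC_t$, $\Gamma_t=\partial_s^2P_t=\partial_s^2C_t$. Conditional statements given $S_t=s$ refer to the transition kernels, for all $s>0$. (A1): $S$ is a one-factor Markov process with respect to $(\mathcal F_t)$, and $S_t$ is continuously distributed; as part of this regularity, option values are taken to be twice differentiable in $K$ and in $s$. (A2): $P_t(\alpha K|\alpha s)=\alpha P_t(K|s)$ for all $\alpha,K,s>0$ and $t=0,\dots,N-1$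 (independent returns). Roll-up guarantee: the guarantee base is $A_t:=\sum_{u=t+1}^N(1+r_R)^{-(u-t)}$ for $t=0,\dots,N-1$, and $A_N:=\infty$. The fund starts at $X_0>0$ with initial withdrawal level $w_0>0$ and evolves as $X_{t+1}=X_t\cdot S_{t+1}/S_t-w_t$; the guaranteed withdrawal level is updated by $w_t=\max(w_{t-1},X_t/A_t)$, $t=1,\dots,N-1$. Depletion time $\tau:=\inf\{t:X_t\le0\}$. Guarantee claims at $T_t$, $t=1,\dots,N$: $Z^{(t)}=w_{t-1}\mathbf 1_{\tau\le t-1}+X_t^-\mathbf 1_{\tau=t}$, with $x^-=-\min(0,x)$. On $\{\tau>t\}$, the value at $T_t$ of all later claims, which depends only on $(w_t,X_t)$, is $\bar V^R_t(w_t,X_t):=\mathbb E_t^{\mathbb Q}\big[\sum_{u=t+1}^NZ^{(u)}\big]$. Equivalently: $\bar V^R_t(w_t,X_t)=\mathbb E^{\mathbb Q}_t[V^R_{t+1}(w_t,X_{t+1})\,|\,X_t]$, where for $\tau\ge t+1$ and $t+1\le N-1$, $V^R_{t+1}(w_t,x)=(N-t-1)w_t-x$ if $-w_t\le x\le0$ and $V^R_{t+1}(w_t,x)=\bar V^R_{t+1}(\max(w_t,x/A_{t+1}),x)$ if $x>0$, and $V^R_N(w_{N-1},x)=x^-$. *)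

theory Defs
  imports "HOL-Probability.Probability"
begin

section \<open>The asset price process\<close>

definition filtration_upto :: "'a measure \<Rightarrow> (nat \<Rightarrow> 'a measure) \<Rightarrow> nat \<Rightarrow> bool" where
  "filtration_upto M F N \<longleftrightarrow>
     (\<forall>t\<le>N. subalgebra M (F t)) \<and> (\<forall>t<N. subalgebra (F (Suc t)) (F t))"

definition adapted_upto :: "(nat \<Rightarrow> 'a measure) \<Rightarrow> (nat \<Rightarrow> 'a \<Rightarrow> real) \<Rightarrow> nat \<Rightarrow> bool" where
  "adapted_upto F S N \<longleftrightarrow> (\<forall>t\<le>N. S t \<in> borel_measurable (F t))"

definition martingale_upto ::
    "'a measure \<Rightarrow> (nat \<Rightarrow> 'a measure) \<Rightarrow> (nat \<Rightarrow> 'a \<Rightarrow> real) \<Rightarrow> nat \<Rightarrow> bool" where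
  "martingale_upto M F S N \<longleftrightarrow> adapted_upto F S N \<and> (\<forall>t\<le>N. integrable M (S t)) \<and>
     (\<forall>t<N. AE \<omega> in M. real_cond_exp M (F t) (S (Suc t)) \<omega> = S t \<omega>)"

text \<open>
  \<open>\<kappa> t s\<close> is the law of \<open>S (t + 1)\<close> given \<open>S t = s\<close>. The state space is the positive
  half line, so only \<open>\<kappa> t s\<close> with \<open>s > 0\<close> is meaningful.
\<close>

definition transition_kernels :: "(nat \<Rightarrow> real \<Rightarrow> real measure) \<Rightarrow> nat \<Rightarrow> bool" where
  "transition_kernels \<kappa> N \<longleftrightarrow> (\<forall>t<N.
     \<kappa> t \<in> restrict_space borel {0<..} \<rightarrow>\<^sub>M prob_algebra borel \<and>
     (\<forall>s>0. AE y in \<kappa> t s. 0 < y))"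

definition markov_upto ::
    "'a measure \<Rightarrow> (nat \<Rightarrow> 'a measure) \<Rightarrow> (nat \<Rightarrow> 'a \<Rightarrow> real) \<Rightarrow>
     (nat \<Rightarrow> real \<Rightarrow> real measure) \<Rightarrow> nat \<Rightarrow> bool" where
  "markov_upto M F S \<kappa> N \<longleftrightarrow> adapted_upto F S N \<and> transition_kernels \<kappa> N \<and>
     (\<forall>t<N. \<forall>B\<in>sets borel. AE \<omega> in M.
        real_cond_exp M (F t) (\<lambda>\<omega>'. indicator B (S (Suc t) \<omega>')) \<omega> = measure (\<kappa> t (S t \<omega>)) B)"


section \<open>One-period options\<close>

text \<open>The arguments are ordered as in \<open>P\<^sub>t(K|s)\<close>: time, strike, current price.\<close>

definition put :: "(nat \<Rightarrow> real \<Rightarrow> real measure) \<Rightarrow> nat \<Rightarrow> real \<Rightarrow> real \<Rightarrow> real" where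
  "put \<kappa> t K s = (\<integral>y. max 0 (K - y) \<partial>\<kappa> t s)"

definition call :: "(nat \<Rightarrow> real \<Rightarrow> real measure) \<Rightarrow> nat \<Rightarrow> real \<Rightarrow> real \<Rightarrow> real" where
  "call \<kappa> t K s = (\<integral>y. max 0 (y - K) \<partial>\<kappa> t s)"

definition put_delta :: "(nat \<Rightarrow> real \<Rightarrow> real measure) \<Rightarrow> nat \<Rightarrow> real \<Rightarrow> real \<Rightarrow> real" where
  "put_delta \<kappa> t K s = deriv (put \<kappa> t K) s"

definition call_delta :: "(nat \<Rightarrow> real \<Rightarrow> real measure) \<Rightarrow> nat \<Rightarrow> real \<Rightarrow> real \<Rightarrow> real" where
  "call_delta \<kappa> t K s = deriv (call \<kappa> t K) s"

definition option_gamma :: "(nat \<Rightarrow> real \<Rightarrow> real measure) \<Rightarrow> nat \<Rightarrow> real \<Rightarrow> real \<Rightarrow> real" where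
  "option_gamma \<kappa> t K s = deriv (put_delta \<kappa> t K) s"

definition twice_differentiable_pos :: "(real \<Rightarrow> real) \<Rightarrow> bool" where
  "twice_differentiable_pos f \<longleftrightarrow>
     (\<forall>x>0. f differentiable (at x)) \<and> (\<forall>x>0. deriv f differentiable (at x))"

text \<open>
  \<open>S 0\<close> is the constant 1, so a continuous distribution can only be required from time 1 on.
\<close>

definition assumption_A1 ::
    "'a measure \<Rightarrow> (nat \<Rightarrow> 'a measure) \<Rightarrow> (nat \<Rightarrow> 'a \<Rightarrow> real) \<Rightarrow>
     (nat \<Rightarrow> real \<Rightarrow> real measure) \<Rightarrow> nat \<Rightarrow> bool" where
  "assumption_A1 M F S \<kappa> N \<longleftrightarrow> markov_upto M F S \<kappa> N \<and>
     (\<forall>t. 1 \<le> t \<and> t \<le> N \<longrightarrow> absolutely_continuous lborel (distr M borel (S t))) \<and>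
     (\<forall>t<N. \<forall>s>0. twice_differentiable_pos (\<lambda>K. put \<kappa> t K s) \<and>
                  twice_differentiable_pos (\<lambda>K. call \<kappa> t K s)) \<and>
     (\<forall>t<N. \<forall>K>0. twice_differentiable_pos (\<lambda>s. put \<kappa> t K s) \<and>
                  twice_differentiable_pos (\<lambda>s. call \<kappa> t K s))"

definition assumption_A2 :: "(nat \<Rightarrow> real \<Rightarrow> real measure) \<Rightarrow> nat \<Rightarrow> bool" where
  "assumption_A2 \<kappa> N \<longleftrightarrow>
     (\<forall>t<N. \<forall>a>0. \<forall>K>0. \<forall>s>0. put \<kappa> t (a * K) (a * s) = a * put \<kappa> t K s)"


section \<open>The guarantee with roll-up\<close>

text \<open>
  Only the values for \<open>t < N\<close> are meaningful. The convention \<open>A\<^sub>N = \<infinity>\<close> is not encoded: below,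
  \<open>guarantee_base N r N\<close> occurs only in factors multiplied by the zero coefficients of
  time \<open>N - 1\<close> (and in \<open>withdrawal\<close> at time \<open>N\<close>, which enters no claim).
\<close>

definition guarantee_base :: "nat \<Rightarrow> real \<Rightarrow> nat \<Rightarrow> real" where
  "guarantee_base N r t = (\<Sum>u = t + 1..N. 1 / (1 + r) ^ (u - t))"

fun fund :: "nat \<Rightarrow> real \<Rightarrow> real \<Rightarrow> real \<Rightarrow> (nat \<Rightarrow> 'a \<Rightarrow> real) \<Rightarrow> nat \<Rightarrow> 'a \<Rightarrow> real"
  and withdrawal :: "nat \<Rightarrow> real \<Rightarrow> real \<Rightarrow> real \<Rightarrow> (nat \<Rightarrow> 'a \<Rightarrow> real) \<Rightarrow> nat \<Rightarrow> 'a \<Rightarrow> real" where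
  "fund N r x\<^sub>0 w\<^sub>0 S 0 \<omega> = x\<^sub>0"
| "fund N r x\<^sub>0 w\<^sub>0 S (Suc t) \<omega> =
     fund N r x\<^sub>0 w\<^sub>0 S t \<omega> * (S (Suc t) \<omega> / S t \<omega>) - withdrawal N r x\<^sub>0 w\<^sub>0 S t \<omega>"
| "withdrawal N r x\<^sub>0 w\<^sub>0 S 0 \<omega> = w\<^sub>0"
| "withdrawal N r x\<^sub>0 w\<^sub>0 S (Suc t) \<omega> =
     max (withdrawal N r x\<^sub>0 w\<^sub>0 S t \<omega>)
         (fund N r x\<^sub>0 w\<^sub>0 S (Suc t) \<omega> / guarantee_base N r (Suc t))"

definition neg_part :: "real \<Rightarrow> real" where
  "neg_part x = - min 0 x"

definition depletion_time ::
    "nat \<Rightarrow> real \<Rightarrow> real \<Rightarrow> real \<Rightarrow> (nat \<Rightarrow> 'a \<Rightarrow> real) \<Rightarrow> 'a \<Rightarrow> enat" where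
  "depletion_time N r x\<^sub>0 w\<^sub>0 S \<omega> = Inf {enat t | t. t \<le> N \<and> fund N r x\<^sub>0 w\<^sub>0 S t \<omega> \<le> 0}"

definition claim ::
    "nat \<Rightarrow> real \<Rightarrow> real \<Rightarrow> real \<Rightarrow> (nat \<Rightarrow> 'a \<Rightarrow> real) \<Rightarrow> nat \<Rightarrow> 'a \<Rightarrow> real" where
  "claim N r x\<^sub>0 w\<^sub>0 S t \<omega> =
     withdrawal N r x\<^sub>0 w\<^sub>0 S (t - 1) \<omega> *
       of_bool (depletion_time N r x\<^sub>0 w\<^sub>0 S \<omega> \<le> enat (t - 1)) +
     neg_part (fund N r x\<^sub>0 w\<^sub>0 S t \<omega>) * of_bool (depletion_time N r x\<^sub>0 w\<^sub>0 S \<omega> = enat t)"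

definition later_claims_value ::
    "'a measure \<Rightarrow> (nat \<Rightarrow> 'a measure) \<Rightarrow> nat \<Rightarrow> real \<Rightarrow> real \<Rightarrow> real \<Rightarrow> (nat \<Rightarrow> 'a \<Rightarrow> real) \<Rightarrow>
     nat \<Rightarrow> 'a \<Rightarrow> real" where
  "later_claims_value M F N r x\<^sub>0 w\<^sub>0 S t =
     real_cond_exp M (F t) (\<lambda>\<omega>. \<Sum>u = t + 1..N. claim N r x\<^sub>0 w\<^sub>0 S u \<omega>)"

text \<open>
  The same value by backward recursion over the transition kernels, as a function of the
  state: price \<open>s\<close>, withdrawal level \<open>w\<close> and fund value \<open>x\<close>. The next fund value \<open>y\<close> is
  almost surely greater than \<open>- w\<close>.
\<close>

function kernel_value ::
    "(nat \<Rightarrow> real \<Rightarrow> real measure) \<Rightarrow> nat \<Rightarrow> real \<Rightarrow> nat \<Rightarrow> real \<Rightarrow> real \<Rightarrow> real \<Rightarrow> real" where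
  "kernel_value \<kappa> N r t s w x = (if N \<le> t then 0 else
     (\<integral>s'. (let y = x * (s' / s) - w in
        if t + 1 = N then neg_part y
        else if y \<le> 0 then real (N - t - 1) * w - y
        else kernel_value \<kappa> N r (t + 1) s' (max w (y / guarantee_base N r (t + 1))) y) \<partial>\<kappa> t s))"
  by pat_completeness auto
termination by (relation "Wellfounded.measure (\<lambda>(\<kappa>, N, r, t, s, w, x). N - t)") auto

declare kernel_value.simps [simp del]


section \<open>The coefficients of the static hedge\<close>

text \<open>
  The measure against which \<open>g\<^sup>R\<^sub>t\<close> is a density: \<open>dk\<close> on \<open>(1, 1 + A\<^sub>t\<^sub>+\<^sub>1]\<close>, except that at
  time \<open>N - 1\<close> the whole object \<open>g\<^sup>R\<^sub>t(k) dk\<close> is the Dirac measure at 1.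
\<close>

definition hedge_measure :: "nat \<Rightarrow> real \<Rightarrow> nat \<Rightarrow> real measure" where
  "hedge_measure N r t =
     (if t + 1 = N then return borel 1
      else restrict_space lborel {1<..1 + guarantee_base N r (t + 1)})"

function (sequential)
      hedge_alpha :: "(nat \<Rightarrow> real \<Rightarrow> real measure) \<Rightarrow> nat \<Rightarrow> real \<Rightarrow> nat \<Rightarrow> real"
  and hedge_beta :: "(nat \<Rightarrow> real \<Rightarrow> real measure) \<Rightarrow> nat \<Rightarrow> real \<Rightarrow> nat \<Rightarrow> real"
  and hedge_g :: "(nat \<Rightarrow> real \<Rightarrow> real measure) \<Rightarrow> nat \<Rightarrow> real \<Rightarrow> nat \<Rightarrow> real \<Rightarrow> real" where
  "hedge_alpha \<kappa> N r t = (if N \<le> t + 1 then 0 else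
     (let A1 = guarantee_base N r (t + 1); A2 = guarantee_base N r (t + 2) in
        hedge_alpha \<kappa> N r (t + 1) * (1 + 1 / A2 * call \<kappa> (t + 1) (1 + A2) A1)
        - hedge_beta \<kappa> N r (t + 1) * put \<kappa> (t + 1) (1 + A2) A1
        + (\<integral>k. put \<kappa> (t + 1) k A1 * hedge_g \<kappa> N r (t + 1) k \<partial>hedge_measure N r (t + 1))))"
| "hedge_beta \<kappa> N r t = (if N \<le> t + 1 then 0 else
     (let A1 = guarantee_base N r (t + 1); A2 = guarantee_base N r (t + 2) in
        hedge_alpha \<kappa> N r (t + 1) / A2 * call_delta \<kappa> (t + 1) (1 + A2) A1
        - hedge_beta \<kappa> N r (t + 1) * put_delta \<kappa> (t + 1) (1 + A2) A1
        + (\<integral>k. put_delta \<kappa> (t + 1) k A1 * hedge_g \<kappa> N r (t + 1) k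
             \<partial>hedge_measure N r (t + 1))))"
| "hedge_g \<kappa> N r t k = (if N \<le> t + 1 then 1 else
     (let A2 = guarantee_base N r (t + 2) in
        (hedge_alpha \<kappa> N r (t + 1) / A2 - hedge_beta \<kappa> N r (t + 1))
          * option_gamma \<kappa> (t + 1) (1 + A2) (k - 1)
        + (\<integral>k'. option_gamma \<kappa> (t + 1) k' (k - 1) * hedge_g \<kappa> N r (t + 1) k'
             \<partial>hedge_measure N r (t + 1))))"
  by pat_completeness auto
termination
  by (relation "Wellfounded.measure (\<lambda>a. case a of
        Inl (\<kappa>, N, r, t) \<Rightarrow> N - t
      | Inr (Inl (\<kappa>, N, r, t)) \<Rightarrow> N - t
      | Inr (Inr (\<kappa>, N, r, t, k)) \<Rightarrow> N - t)") auto

declare hedge_alpha.simps [simp del] hedge_beta.simps [simp del] hedge_g.simps [simp del]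

text \<open>The value of the hedge portfolio at withdrawal level \<open>w\<close> and fund value \<open>x\<close>.\<close>

definition hedge_value ::
    "(nat \<Rightarrow> real \<Rightarrow> real measure) \<Rightarrow> nat \<Rightarrow> real \<Rightarrow> nat \<Rightarrow> real \<Rightarrow> real \<Rightarrow> real" where
  "hedge_value \<kappa> N r t w x =
     (let A1 = guarantee_base N r (t + 1) in
        hedge_alpha \<kappa> N r t * (w + 1 / A1 * call \<kappa> t (w * (1 + A1)) x)
        - hedge_beta \<kappa> N r t * put \<kappa> t (w * (1 + A1)) x
        + (\<integral>k. put \<kappa> t (w * k) x * hedge_g \<kappa> N r t k \<partial>hedge_measure N r t))"

end

(*
  The one-period returns S (t + 1) / S t are independent of the past with law kappa t 1: homogeneity
  of the puts determines the kernels up to scaling, since a put determines the law through its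
  derivative in the strike. A claim at time t + 1 depends on the return only through the next fund
  value. Per unit of withdrawal level, the value at time t + 1 is a function of the fund value that
  is linear beyond A (t + 1) (the withdrawal level is reset, and the value is homogeneous) and
  linear below 0 (the fund is depleted). In between, it is the time t + 1 hedge value, whose second
  derivative is g t. Taylor's formula around A (t + 1) therefore writes it as a constant, a call
  and a put struck at 1 + A (t + 1), and a mixture of puts with density g t. Taking
  expectations gives the formula at time t.

  Gammas need not be continuous or bounded, so g t is only an integrable function. Nothing is
  differentiated under an integral: Taylor's formula is applied to each put separately and
  then integrated by Fubini, the mass of each gamma on (0, b] being at most 1.
*)
theory Submission
  imports Defs
begin

section \<open>One-period options under scaling kernels\<close>

text \<open>For t < N - 1, \<open>\<alpha> t\<close> and \<open>\<beta> t\<close> are the value and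
  the slope at fund value \<open>A (t + 1)\<close> of the time t + 1 hedge value with withdrawal
  level 1. To the right of that point the reset makes the value
  \<open>\<alpha> t / A (t + 1)\<close> times the fund value, and this slope need not agree with
  \<open>\<beta> t\<close>; the possible kink is why the call and the put carry different
  coefficients. Homogeneity replaces continuity of the gammas. It makes the put delta
  \<open>- partial_mean (K / s)\<close>, where \<open>partial_mean\<close> is a distribution
  function, so gammas are nonnegative with known mass. Integrability of \<open>g\<close> then comes
  from Taylor's formula itself, evaluated at -1 and at 0. The delicate point is fund value 0.
  Continued by the payoff of a depleted fund, every put is C^1 there, so before N - 1 the mixture
  has no atom at strike 1; at N - 1 the payoff is itself a single put, hence the Dirac measure. The
  conditional expectation and the kernel recursion are treated separately, but both rest on the same
  identity for the payoff of the portfolio and on its expectation under the return law.\<close>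

lemma put_difference_quotient_tendsto_cdf:
  assumes "real_distribution \<mu>"
    and pos: "AE y in \<mu>. 0 < y"
  shows "(\<lambda>n. ((\<integral>y. max 0 (K + 1 / real (Suc n) - y) \<partial>\<mu>) - (\<integral>y. max 0 (K - y) \<partial>\<mu>)) * real (Suc n))
           \<longlonglongrightarrow> cdf \<mu> K"
proof -
  interpret real_distribution \<mu> by fact
  have int: "integrable \<mu> (\<lambda>y. max 0 (L - y))" for L :: real
    by (rule integrable_const_bound[where B = "\<bar>L\<bar>"]) (use pos in auto)
  have eq: "((\<integral>y. max 0 (K + 1 / real (Suc n) - y) \<partial>\<mu>) - (\<integral>y. max 0 (K - y) \<partial>\<mu>)) * real (Suc n)
     = (\<integral>y. (max 0 (K + 1 / real (Suc n) - y) - max 0 (K - y)) * real (Suc n) \<partial>\<mu>)" for n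
    by (simp add: int)
  \<comment> \<open>The quotients are taken from the right, so they equal 1 also at y = K, and the
    limit is the indicator of the closed half-line: it integrates to \<open>cdf \<mu> K\<close> even
    if \<open>\<mu>\<close> has an atom at K. Domination by 1 is the Lipschitz bound of the positive
    part.\<close>
  have "(\<lambda>n. \<integral>y. (max 0 (K + 1 / real (Suc n) - y) - max 0 (K - y)) * real (Suc n) \<partial>\<mu>)
          \<longlonglongrightarrow> (\<integral>y. indicator {..K} y \<partial>\<mu>)"
  proof (rule integral_dominated_convergence[where w = "\<lambda>_. 1"])
    show "AE y in \<mu>. (\<lambda>n. (max 0 (K + 1 / real (Suc n) - y) - max 0 (K - y)) * real (Suc n))
        \<longlonglongrightarrow> indicator {..K} y"
    proof (rule AE_I2)
      fix y
      show "(\<lambda>n. (max 0 (K + 1 / real (Suc n) - y) - max 0 (K - y)) * real (Suc n))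
        \<longlonglongrightarrow> indicator {..K} y"
      proof (cases "y \<le> K")
        case True
        have "(max 0 (K + 1 / real (Suc n) - y) - max 0 (K - y)) * real (Suc n) = 1" for n
        proof -
          have "0 \<le> 1 / real (Suc n)" by simp
          with True have "max 0 (K + 1 / real (Suc n) - y) = K + 1 / real (Suc n) - y"
            "max 0 (K - y) = K - y" by linarith+
          then show ?thesis by (simp add: field_simps)
        qed
        with True show ?thesis by simp
      next
        case False
        have "(\<lambda>n. K + 1 / real (Suc n)) \<longlonglongrightarrow> K + 0"
          by (intro tendsto_intros LIMSEQ_inverse_real_of_nat[unfolded inverse_eq_divide])
        with False have "\<forall>\<^sub>F n in sequentially. K + 1 / real (Suc n) < y"
          by (intro order_tendstoD(2)) auto
        then have "\<forall>\<^sub>F n in sequentially.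
            (max 0 (K + 1 / real (Suc n) - y) - max 0 (K - y)) * real (Suc n) = indicator {..K} y"
          by eventually_elim (use False in auto)
        then show ?thesis by (rule tendsto_eventually)
      qed
    qed
    show "AE y in \<mu>. norm ((max 0 (K + 1 / real (Suc n) - y) - max 0 (K - y)) * real (Suc n)) \<le> 1" for n
    proof (rule AE_I2)
      fix y
      have "0 \<le> 1 / real (Suc n)" by simp
      then have "\<bar>max 0 (K + 1 / real (Suc n) - y) - max 0 (K - y)\<bar> \<le> 1 / real (Suc n)"
        by linarith
      then have "\<bar>max 0 (K + 1 / real (Suc n) - y) - max 0 (K - y)\<bar> * real (Suc n) \<le> 1"
        by (subst (asm) pos_le_divide_eq) auto
      then show "norm ((max 0 (K + 1 / real (Suc n) - y) - max 0 (K - y)) * real (Suc n)) \<le> 1"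
        by (simp only: real_norm_def abs_mult abs_of_nat)
    qed
  qed simp_all
  then show ?thesis
    unfolding eq by (simp add: cdf_def)
qed

text \<open>Comparing positive strikes suffices: both laws live on the positive half-line, so puts
  with strike at most 0 vanish.\<close>

lemma real_distribution_eqI_put:
  assumes "real_distribution \<mu>" "real_distribution \<nu>"
    and "AE y in \<mu>. 0 < y" "AE y in \<nu>. 0 < y"
    and put: "\<And>K. 0 < K \<Longrightarrow> (\<integral>y. max 0 (K - y) \<partial>\<mu>) = (\<integral>y. max 0 (K - y) \<partial>\<nu>)"
  shows "\<mu> = \<nu>"
proof (rule cdf_unique[OF assms(1,2)], rule ext)
  interpret \<mu>: real_distribution \<mu> by fact
  interpret \<nu>: real_distribution \<nu> by fact
  fix K
  have eq: "(\<integral>y. max 0 (L - y) \<partial>\<mu>) = (\<integral>y. max 0 (L - y) \<partial>\<nu>)" for L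
  proof (cases "0 < L")
    case False
    have "(\<integral>y. max 0 (L - y) \<partial>\<mu>) = 0" "(\<integral>y. max 0 (L - y) \<partial>\<nu>) = 0"
      using assms(3,4) False by (auto intro!: integral_eq_zero_AE)
    then show ?thesis by simp
  qed (rule put)
  show "cdf \<mu> K = cdf \<nu> K"
    using put_difference_quotient_tendsto_cdf[OF assms(1,3), of K]
      put_difference_quotient_tendsto_cdf[OF assms(2,4), of K]
    unfolding eq by (rule LIMSEQ_unique)
qed

text \<open>One period, with everything expressed through the return law
  \<open>\<kappa> t 1\<close>. Smoothness is recorded in the strike at price 1; smoothness in the
  price is derived from it by homogeneity.\<close>

locale scaling_period = real_distribution "\<kappa> t 1"
  for \<kappa> :: "nat \<Rightarrow> real \<Rightarrow> real measure" and t :: nat +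
  assumes return_pos: "AE y in \<kappa> t 1. 0 < y"
    and return_integrable: "integrable (\<kappa> t 1) (\<lambda>y. y)"
    and return_mean: "(\<integral>y. y \<partial>\<kappa> t 1) = 1"
    and kernel_scale: "0 < s \<Longrightarrow> \<kappa> t s = distr (\<kappa> t 1) borel (\<lambda>y. s * y)"
    and put_smooth: "twice_differentiable_pos (\<lambda>K. put \<kappa> t K 1)"
begin

text \<open>The distribution function of the return under the asset as numeraire, that is, under the
  law with density y, a probability because the mean return is 1. Its negative at K / s turns out to
  be the put delta.\<close>

definition partial_mean :: "real \<Rightarrow> real" where
  "partial_mean x = (\<integral>y. y * indicator {..x} y \<partial>\<kappa> t 1)"

text \<open>Differentiability is known only at positive arguments. The default 0 elsewhere makes the
  function nonnegative and Borel on the whole line.\<close>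

definition partial_mean_deriv :: "real \<Rightarrow> real" where
  "partial_mean_deriv x = (if 0 < x then deriv partial_mean x else 0)"

lemma prob_UNIV [simp]: "prob UNIV = 1"
  using prob_space by simp

lemma put_integrable: "integrable (\<kappa> t 1) (\<lambda>y. max 0 (L - c * y))" if "0 \<le> c"
proof (rule integrable_const_bound[where B = "\<bar>L\<bar>"])
  show "AE y in \<kappa> t 1. norm (max 0 (L - c * y)) \<le> \<bar>L\<bar>"
    using return_pos
  proof eventually_elim
    case (elim y)
    then have "0 \<le> c * y" using that by simp
    then show ?case by auto
  qed
qed auto

lemma put_eq: "put \<kappa> t K s = (\<integral>y. max 0 (K - s * y) \<partial>\<kappa> t 1)" if "0 < s"
  unfolding put_def kernel_scale[OF that] by (subst integral_distr) auto

lemma put_homogeneous: "put \<kappa> t (a * K) (a * s) = a * put \<kappa> t K s" if "0 < s" "0 < a"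
proof -
  have "max 0 (a * K - a * s * y) = a * max 0 (K - s * y)" for y
    using that by (simp add: max_mult_distrib_left algebra_simps)
  then show ?thesis
    using that by (simp add: put_eq)
qed

lemma put_unit: "put \<kappa> t K s = s * put \<kappa> t (K / s) 1" if "0 < s"
proof -
  have "put \<kappa> t (s * (K / s)) (s * 1) = s * put \<kappa> t (K / s) 1"
    using that by (intro put_homogeneous) auto
  then show ?thesis using that by (simp only: mult_1_right) simp
qed

lemma put_nonpos_strike: "put \<kappa> t K s = 0" if "K \<le> 0" "0 < s"
  unfolding put_eq[OF that(2)]
proof (rule integral_eq_zero_AE)
  show "AE y in \<kappa> t 1. max 0 (K - s * y) = 0"
    using return_pos
  proof eventually_elim
    case (elim y)
    then have "0 < s * y" using that by simp
    then show ?case using that by auto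
  qed
qed

lemma put_bounds: "0 \<le> put \<kappa> t K s \<and> put \<kappa> t K s \<le> \<bar>K\<bar>" if "0 < s"
proof -
  have "(\<integral>y. max 0 (K - s * y) \<partial>\<kappa> t 1) \<le> (\<integral>y. \<bar>K\<bar> \<partial>\<kappa> t 1)"
  proof (rule integral_mono_AE)
    show "AE y in \<kappa> t 1. max 0 (K - s * y) \<le> \<bar>K\<bar>"
      using return_pos
    proof eventually_elim
      case (elim y)
      then have "0 < s * y" using that by simp
      then show ?case by auto
    qed
  qed (use put_integrable[of s K] that in simp_all)
  then show ?thesis
    by (simp add: put_eq[OF that])
qed

lemma call_eq: "call \<kappa> t K s = s - K + put \<kappa> t K s" if "0 < s"
proof -
  have "call \<kappa> t K s = (\<integral>y. max 0 (s * y - K) \<partial>\<kappa> t 1)"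
    unfolding call_def kernel_scale[OF that] by (subst integral_distr) auto
  also have "\<dots> = (\<integral>y. s * y - K + max 0 (K - s * y) \<partial>\<kappa> t 1)"
    by (intro Bochner_Integration.integral_cong) auto
  also have "\<dots> = s - K + put \<kappa> t K s"
    using that return_integrable put_integrable[of s K]
    by (simp add: put_eq return_mean prob_space)
  finally show ?thesis .
qed

text \<open>Smoothness supplies some two-sided derivative; its value is read off along the sequence
  1 / (n + 1), where the quotients tend to the distribution function.\<close>

lemma put_strike_deriv: "((\<lambda>K. put \<kappa> t K 1) has_real_derivative cdf (\<kappa> t 1) K) (at K)" if "0 < K"
proof -
  let ?p = "\<lambda>K. put \<kappa> t K 1"
  from put_smooth that have "?p differentiable (at K)"
    by (simp add: twice_differentiable_pos_def)
  then obtain D where D: "(?p has_real_derivative D) (at K)"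
    by (auto simp: real_differentiable_def)
  then have "((\<lambda>h. (?p (K + h) - ?p K) / h) \<longlongrightarrow> D) (at 0)"
    by (simp add: DERIV_def)
  moreover have "filterlim (\<lambda>n. 1 / real (Suc n)) (at 0) sequentially"
    unfolding filterlim_at
    using LIMSEQ_inverse_real_of_nat by (auto simp: inverse_eq_divide)
  ultimately have "(\<lambda>n. (?p (K + 1 / real (Suc n)) - ?p K) / (1 / real (Suc n))) \<longlonglongrightarrow> D"
    by (rule filterlim_compose)
  moreover have "(\<lambda>n. (?p (K + 1 / real (Suc n)) - ?p K) / (1 / real (Suc n))) \<longlonglongrightarrow> cdf (\<kappa> t 1) K"
    using put_difference_quotient_tendsto_cdf[OF real_distribution_axioms return_pos, of K]
    by (simp add: put_def)
  ultimately have "D = cdf (\<kappa> t 1) K"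
    by (rule LIMSEQ_unique)
  with D show ?thesis by simp
qed

section \<open>The return law under the asset as numeraire\<close>

lemma partial_mean_integrable: "integrable (\<kappa> t 1) (\<lambda>y. y * indicator {..x} y)"
  using integrable_mult_indicator[OF _ return_integrable, of "{..x}"] by (simp add: mult.commute)

text \<open>On y <= x one has y = x - (x - y). The right-hand side involves only the put and its
  strike derivative, so second differentiability in the strike makes \<open>partial_mean\<close>
  differentiable.\<close>

lemma partial_mean_eq: "partial_mean x = x * cdf (\<kappa> t 1) x - put \<kappa> t x 1"
proof -
  have "partial_mean x = (\<integral>y. x * indicator {..x} y - max 0 (x - 1 * y) \<partial>\<kappa> t 1)"
    unfolding partial_mean_def
    by (intro Bochner_Integration.integral_cong) (auto split: split_indicator)
  also have "\<dots> = x * cdf (\<kappa> t 1) x - put \<kappa> t x 1"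
    using integrable_real_indicator[of "{..x}" "\<kappa> t 1"] put_integrable[of 1 x] by (subst Bochner_Integration.integral_diff) (auto simp: put_eq cdf_def emeasure_eq_measure)
  finally show ?thesis .
qed

lemma partial_mean_nonpos: "partial_mean x = 0" if "x \<le> 0"
  unfolding partial_mean_def
proof (rule integral_eq_zero_AE)
  show "AE y in \<kappa> t 1. y * indicator {..x} y = 0"
    using return_pos by eventually_elim (use that in \<open>auto split: split_indicator\<close>)
qed

lemma partial_mean_mono: "mono partial_mean"
proof
  fix x y :: real assume "x \<le> y"
  show "partial_mean x \<le> partial_mean y"
    unfolding partial_mean_def
  proof (rule integral_mono_AE[OF partial_mean_integrable partial_mean_integrable])
    show "AE z in \<kappa> t 1. z * indicator {..x} z \<le> z * indicator {..y} z"
      using return_pos by eventually_elim (use \<open>x \<le> y\<close> in \<open>auto split: split_indicator\<close>)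
  qed
qed

lemma partial_mean_nonneg: "0 \<le> partial_mean x"
proof -
  have "partial_mean (min x 0) \<le> partial_mean x"
    by (rule monoD[OF partial_mean_mono]) simp
  moreover have "partial_mean (min x 0) = 0"
    by (rule partial_mean_nonpos) simp
  ultimately show ?thesis by simp
qed

lemma partial_mean_le_1: "partial_mean x \<le> 1"
proof -
  have "partial_mean x \<le> (\<integral>y. y \<partial>\<kappa> t 1)"
    unfolding partial_mean_def
  proof (rule integral_mono_AE[OF partial_mean_integrable return_integrable])
    show "AE y in \<kappa> t 1. y * indicator {..x} y \<le> y"
      using return_pos by eventually_elim (auto split: split_indicator)
  qed
  then show ?thesis by (simp add: return_mean)
qed

lemma partial_mean_at_top: "(partial_mean \<longlongrightarrow> 1) at_top"
proof -
  have "((\<lambda>x. \<integral>y. y * indicator {..x} y \<partial>\<kappa> t 1) \<longlongrightarrow> (\<integral>y. y \<partial>\<kappa> t 1)) at_top"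
  proof (rule integral_dominated_convergence_at_top[where w = "\<lambda>y. \<bar>y\<bar>"])
    show "AE y in \<kappa> t 1. ((\<lambda>x. y * indicator {..x} y) \<longlongrightarrow> y) at_top"
    proof (rule AE_I2, rule tendsto_eventually)
      fix y :: real
      show "\<forall>\<^sub>F x in at_top. y * indicator {..x} y = y"
        using eventually_ge_at_top[of y] by eventually_elim auto
    qed
    show "\<forall>\<^sub>F x in at_top. AE y in \<kappa> t 1. norm (y * indicator {..x} y) \<le> \<bar>y\<bar>"
      by (intro always_eventually allI AE_I2) (simp add: indicator_def)
    show "integrable (\<kappa> t 1) (\<lambda>y. \<bar>y\<bar>)"
      using return_integrable by (rule integrable_abs)
  qed measurable
  then show ?thesis
    by (simp add: return_mean partial_mean_def[abs_def])
qed

lemma partial_mean_has_deriv: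
  "(partial_mean has_real_derivative partial_mean_deriv x) (at x)" if "0 < x"
proof -
  let ?p = "\<lambda>K. put \<kappa> t K 1"
  from put_smooth that have "deriv ?p differentiable (at x)"
    by (simp add: twice_differentiable_pos_def)
  then obtain D where "(deriv ?p has_real_derivative D) (at x)"
    by (auto simp: real_differentiable_def)
  moreover have "\<forall>\<^sub>F y in nhds x. deriv ?p y = cdf (\<kappa> t 1) y"
    using eventually_nhds_in_open[of "{0<..}" x] that
    by (auto elim!: eventually_mono intro!: DERIV_imp_deriv put_strike_deriv)
  ultimately have "(cdf (\<kappa> t 1) has_real_derivative D) (at x)"
    by (subst (asm) DERIV_cong_ev) auto
  \<comment> \<open>In the product rule the two distribution functions cancel: the derivative is x
    times the second strike derivative of the put.\<close>
  then have "((\<lambda>x. x * cdf (\<kappa> t 1) x - ?p x) has_real_derivative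
      (1 * cdf (\<kappa> t 1) x + D * x - cdf (\<kappa> t 1) x)) (at x)"
    by (intro derivative_intros put_strike_deriv that)
  then have "(partial_mean has_real_derivative
      (1 * cdf (\<kappa> t 1) x + D * x - cdf (\<kappa> t 1) x)) (at x)"
    by (simp add: partial_mean_eq[abs_def])
  from DERIV_imp_deriv[OF this] this show ?thesis
    using that by (simp add: partial_mean_deriv_def)
qed

lemma partial_mean_measurable [measurable]: "partial_mean \<in> borel_measurable borel"
  by (rule borel_measurable_mono[OF partial_mean_mono])

lemma partial_mean_deriv_nonneg: "0 \<le> partial_mean_deriv x"
proof (cases "0 < x")
  case True
  from partial_mean_has_deriv[OF this] show ?thesis
    by (rule mono_on_imp_deriv_nonneg[rotated, where A = UNIV])
      (auto intro: mono_on_subset partial_mean_mono)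
qed (simp add: partial_mean_deriv_def)

text \<open>A derivative may be discontinuous, but it is the pointwise limit of difference quotients
  along 1 / (n + 1); the indicator enforces the default 0.\<close>

lemma partial_mean_deriv_measurable [measurable]: "partial_mean_deriv \<in> borel_measurable borel"
proof (rule borel_measurable_LIMSEQ_real)
  fix x :: real
  show "(\<lambda>n. indicator {0<..} x *
      ((partial_mean (x + 1 / real (Suc n)) - partial_mean x) / (1 / real (Suc n))))
      \<longlonglongrightarrow> partial_mean_deriv x"
  proof (cases "0 < x")
    case True
    have "((\<lambda>h. (partial_mean (x + h) - partial_mean x) / h) \<longlongrightarrow> partial_mean_deriv x) (at 0)"
      using partial_mean_has_deriv[OF True] by (simp add: DERIV_def)
    moreover have "filterlim (\<lambda>n. 1 / real (Suc n)) (at 0) sequentially"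
      unfolding filterlim_at
      using LIMSEQ_inverse_real_of_nat by (auto simp: inverse_eq_divide)
    ultimately have "(\<lambda>n. (partial_mean (x + 1 / real (Suc n)) - partial_mean x) / (1 / real (Suc n)))
        \<longlonglongrightarrow> partial_mean_deriv x"
      by (rule filterlim_compose)
    with True show ?thesis by simp
  qed (simp add: partial_mean_deriv_def)
qed auto

section \<open>Deltas and gammas by homogeneity\<close>

lemma put_price_deriv:
  "(put \<kappa> t K has_real_derivative - partial_mean (K / s)) (at s)" if "0 < s"
proof (cases "0 < K")
  case True
  \<comment> \<open>Homogeneity turns a price derivative into a strike derivative: with p the put at
    price 1, differentiating s * p (K / s) gives p (K / s) - (K / s) * p' (K / s), which is
    \<open>- partial_mean (K / s)\<close>.\<close>
  have "((\<lambda>s. s * put \<kappa> t (K / s) 1) has_real_derivative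
      1 * put \<kappa> t (K / s) 1 + (cdf (\<kappa> t 1) (K / s) * (- K / s\<^sup>2)) * s) (at s)"
    using that True
    by (intro DERIV_mult DERIV_ident DERIV_chain2[where f = "\<lambda>K. put \<kappa> t K 1"] put_strike_deriv)
      (auto intro!: derivative_eq_intros simp: power2_eq_square)
  moreover have "1 * put \<kappa> t (K / s) 1 + (cdf (\<kappa> t 1) (K / s) * (- K / s\<^sup>2)) * s = - partial_mean (K / s)"
    using that by (simp add: partial_mean_eq field_simps power2_eq_square)
  moreover have "\<forall>\<^sub>F u in nhds s. put \<kappa> t K u = u * put \<kappa> t (K / u) 1"
    using eventually_nhds_in_open[of "{0<..}" s] that
    by (auto elim!: eventually_mono simp: put_unit[of _ K])
  ultimately show ?thesis
    by (subst DERIV_cong_ev[OF refl _ refl]) auto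
next
  case False
  have "\<forall>\<^sub>F u in nhds s. put \<kappa> t K u = 0"
    using eventually_nhds_in_open[of "{0<..}" s] that False
    by (auto elim!: eventually_mono intro!: put_nonpos_strike)
  moreover have "partial_mean (K / s) = 0"
    using False that by (intro partial_mean_nonpos) (auto simp: divide_le_0_iff)
  ultimately show ?thesis
    by (subst DERIV_cong_ev[OF refl _ refl]) auto
qed

lemma put_delta_eq: "put_delta \<kappa> t K s = - partial_mean (K / s)" if "0 < s"
  unfolding put_delta_def by (rule DERIV_imp_deriv[OF put_price_deriv[OF that]])

lemma call_delta_eq: "call_delta \<kappa> t K s = 1 + put_delta \<kappa> t K s" if "0 < s"
proof -
  have "((\<lambda>u. u - K + put \<kappa> t K u) has_real_derivative (1 - 0 + - partial_mean (K / s))) (at s)"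
    by (intro derivative_intros put_price_deriv that)
  moreover have "\<forall>\<^sub>F u in nhds s. call \<kappa> t K u = u - K + put \<kappa> t K u"
    using eventually_nhds_in_open[of "{0<..}" s] that
    by (auto elim!: eventually_mono simp: call_eq)
  ultimately have "(call \<kappa> t K has_real_derivative (1 - 0 + - partial_mean (K / s))) (at s)"
    by (subst DERIV_cong_ev[OF refl _ refl]) auto
  then show ?thesis
    using that by (simp add: call_delta_def put_delta_eq DERIV_imp_deriv)
qed

lemma put_delta_has_deriv:
  "(put_delta \<kappa> t K has_real_derivative partial_mean_deriv (K / s) * (K / s\<^sup>2)) (at s)" if "0 < s"
proof -
  have ev: "\<forall>\<^sub>F u in nhds s. 0 < u"
    using eventually_nhds_in_open[of "{0<..}" s] that by auto
  show ?thesis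
  proof (cases "0 < K")
    case True
    have "((\<lambda>u. - partial_mean (K / u)) has_real_derivative
        - (partial_mean_deriv (K / s) * (- K / s\<^sup>2))) (at s)"
      using that True
      by (intro DERIV_minus DERIV_chain2[where f = partial_mean] partial_mean_has_deriv)
        (auto intro!: derivative_eq_intros simp: power2_eq_square)
    moreover have "\<forall>\<^sub>F u in nhds s. put_delta \<kappa> t K u = - partial_mean (K / u)"
      using ev by eventually_elim (rule put_delta_eq)
    ultimately show ?thesis
      by (subst DERIV_cong_ev[OF refl _ refl]) auto
  next
    case False
    have "\<forall>\<^sub>F u in nhds s. put_delta \<kappa> t K u = 0"
      using ev
      by eventually_elim (use False in \<open>auto simp: put_delta_eq divide_le_0_iff intro!: partial_mean_nonpos\<close>)
    moreover have "partial_mean_deriv (K / s) = 0"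
      using False that by (auto simp: partial_mean_deriv_def zero_less_divide_iff)
    ultimately show ?thesis
      by (subst DERIV_cong_ev[OF refl _ refl]) auto
  qed
qed

lemma option_gamma_eq: "option_gamma \<kappa> t K s = partial_mean_deriv (K / s) * (K / s\<^sup>2)" if "0 < s"
  unfolding option_gamma_def by (rule DERIV_imp_deriv[OF put_delta_has_deriv[OF that]])

end

lemma integrable_bounded_mult:
  fixes f g :: "'a \<Rightarrow> real"
  assumes "integrable M g" "f \<in> borel_measurable M" "AE x in M. \<bar>f x\<bar> \<le> C"
  shows "integrable M (\<lambda>x. f x * g x)"
proof (rule Bochner_Integration.integrable_bound)
  show "integrable M (\<lambda>x. C * g x)" using assms(1) by simp
  show "(\<lambda>x. f x * g x) \<in> borel_measurable M" using assms(1,2) by simp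
  show "AE x in M. norm (f x * g x) \<le> norm (C * g x)"
    using assms(3)
  proof eventually_elim
    case (elim x)
    then have "\<bar>f x\<bar> \<le> \<bar>C\<bar>" by simp
    then show ?case by (simp add: abs_mult mult_right_mono)
  qed
qed

text \<open>
  For \<open>z \<le> 0\<close> the put is continued by the payoff of a depleted fund. The result is \<open>C\<^sup>1\<close> at 0,
  because the put tends to \<open>K\<close> and its delta to \<open>- 1\<close> as \<open>z\<close> decreases to 0.
\<close>

definition put_ext :: "(nat \<Rightarrow> real \<Rightarrow> real measure) \<Rightarrow> nat \<Rightarrow> real \<Rightarrow> real \<Rightarrow> real" where
  "put_ext \<kappa> t K z = (if 0 < z then put \<kappa> t K z else K - z)"

definition delta_ext :: "(nat \<Rightarrow> real \<Rightarrow> real measure) \<Rightarrow> nat \<Rightarrow> real \<Rightarrow> real \<Rightarrow> real" where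
  "delta_ext \<kappa> t K z = (if 0 < z then put_delta \<kappa> t K z else -1)"

context scaling_period
begin

text \<open>The shape of the Black-Scholes put formula: strike times exercise probability minus
  price times exercise probability under the asset as numeraire. Both probabilities are monotone in
  the strike, hence measurable, and for K > 0 both tend to 1 as the price decreases to 0.\<close>

lemma put_cdf: "put \<kappa> t K s = K * cdf (\<kappa> t 1) (K / s) - s * partial_mean (K / s)" if "0 < s"
  using that by (simp add: put_unit[OF that, of K] partial_mean_eq field_simps)

lemma cdf_measurable: "cdf (\<kappa> t 1) \<in> borel_measurable borel"
  by (rule borel_measurable_mono) (auto intro!: monoI cdf_nondecreasing)

lemma put_measurable: "(\<lambda>K. put \<kappa> t K s) \<in> borel_measurable borel" if "0 < s"
proof -
  note cdf_measurable [measurable]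
  show ?thesis
    unfolding put_cdf[OF that] by measurable
qed

lemma put_delta_measurable: "(\<lambda>K. put_delta \<kappa> t K s) \<in> borel_measurable borel" if "0 < s"
  unfolding put_delta_eq[OF that] by measurable

lemma put_ext_measurable: "(\<lambda>K. put_ext \<kappa> t K z) \<in> borel_measurable borel"
  by (cases "0 < z") (auto simp: put_ext_def put_measurable)

lemma put_ext_bound: "\<bar>put_ext \<kappa> t K z\<bar> \<le> \<bar>K\<bar> + \<bar>z\<bar>"
  using put_bounds[of z K] by (auto simp: put_ext_def)

lemma put_delta_bounds: "-1 \<le> put_delta \<kappa> t K s \<and> put_delta \<kappa> t K s \<le> 0" if "0 < s"
  using that by (simp add: put_delta_eq partial_mean_nonneg partial_mean_le_1)

lemma option_gamma_nonneg: "0 \<le> option_gamma \<kappa> t K s" if "0 < K" "0 < s"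
  using that by (simp add: option_gamma_eq partial_mean_deriv_nonneg)

lemma strike_ratio_at_top: "filterlim (\<lambda>u. K / u) at_top (at_right 0)" if "0 < K" for K :: real
  unfolding divide_inverse
  by (rule filterlim_tendsto_pos_mult_at_top[OF tendsto_const that filterlim_inverse_at_top_right])

lemma delta_ext_has_deriv:
  "(delta_ext \<kappa> t K has_real_derivative option_gamma \<kappa> t K s) (at s)" if "0 < s"
proof -
  have "\<forall>\<^sub>F u in nhds s. delta_ext \<kappa> t K u = put_delta \<kappa> t K u"
    using eventually_nhds_in_open[of "{0<..}" s] that
    by (auto elim!: eventually_mono simp: delta_ext_def)
  then show ?thesis
    using put_delta_has_deriv[OF that, of K] option_gamma_eq[OF that, of K]
    by (subst DERIV_cong_ev[OF refl _ refl]) auto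
qed

lemma put_ext_has_deriv:
  "(put_ext \<kappa> t K has_real_derivative delta_ext \<kappa> t K s) (at s)" if "0 < s"
proof -
  have "\<forall>\<^sub>F u in nhds s. put_ext \<kappa> t K u = put \<kappa> t K u"
    using eventually_nhds_in_open[of "{0<..}" s] that
    by (auto elim!: eventually_mono simp: put_ext_def)
  then show ?thesis
    using put_price_deriv[OF that, of K] put_delta_eq[OF that, of K] that
    by (subst DERIV_cong_ev[OF refl _ refl]) (auto simp: delta_ext_def)
qed

lemma delta_ext_continuous: "continuous_on {0..} (delta_ext \<kappa> t K)" if "0 < K"
  unfolding continuous_on_eq_continuous_within
proof
  fix x :: real assume "x \<in> {0..}"
  then consider "0 < x" | "x = 0" by force
  then show "continuous (at x within {0..}) (delta_ext \<kappa> t K)"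
  proof cases
    case 1
    show ?thesis
      by (rule continuous_at_imp_continuous_at_within[OF DERIV_isCont[OF delta_ext_has_deriv[OF 1]]])
  next
    case 2
    have "((\<lambda>u. - partial_mean (K / u)) \<longlongrightarrow> - 1) (at_right 0)"
      by (intro tendsto_minus filterlim_compose[OF partial_mean_at_top] strike_ratio_at_top that)
    moreover have "\<forall>\<^sub>F u in at_right 0. - partial_mean (K / u) = delta_ext \<kappa> t K u"
      using eventually_at_right_less[of 0]
      by eventually_elim (simp add: delta_ext_def put_delta_eq)
    ultimately have "(delta_ext \<kappa> t K \<longlongrightarrow> - 1) (at_right 0)"
      by (rule Lim_transform_eventually)
    with 2 show ?thesis
      by (simp add: continuous_within at_within_Ici_at_right delta_ext_def)
  qed
qed

lemma put_ext_continuous: "continuous_on {0..} (put_ext \<kappa> t K)" if "0 < K"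
  unfolding continuous_on_eq_continuous_within
proof
  fix x :: real assume "x \<in> {0..}"
  then consider "0 < x" | "x = 0" by force
  then show "continuous (at x within {0..}) (put_ext \<kappa> t K)"
  proof cases
    case 1
    show ?thesis
      by (rule continuous_at_imp_continuous_at_within[OF DERIV_isCont[OF put_ext_has_deriv[OF 1]]])
  next
    case 2
    have "((\<lambda>u. K * cdf (\<kappa> t 1) (K / u) - u * partial_mean (K / u)) \<longlongrightarrow> K * 1 - 0 * 1) (at_right 0)"
      by (intro tendsto_intros filterlim_compose[OF partial_mean_at_top]
          filterlim_compose[OF cdf_lim_at_top_prob] strike_ratio_at_top that)
    moreover have "\<forall>\<^sub>F u in at_right 0. K * cdf (\<kappa> t 1) (K / u) - u * partial_mean (K / u) = put_ext \<kappa> t K u"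
      using eventually_at_right_less[of 0]
      by eventually_elim (simp add: put_ext_def put_cdf)
    ultimately have "(put_ext \<kappa> t K \<longlongrightarrow> K * 1 - 0 * 1) (at_right 0)"
      by (rule Lim_transform_eventually)
    with 2 show ?thesis
      by (simp add: continuous_within at_within_Ici_at_right put_ext_def)
  qed
qed

section \<open>Taylor's formula for a put and for mixtures of puts\<close>

text \<open>
  Taylor's formula with integral remainder around \<open>b\<close>. The gamma need not be continuous, but the
  gauge integral recovers a function from any derivative, and a nonnegative gauge integrable
  function is Lebesgue integrable.
\<close>

lemma gamma_moment:
  assumes "0 < K" "0 < b" "z \<le> b"
  shows "has_bochner_integral (restrict_space lborel {1<..1 + b})
    (\<lambda>k. max 0 (k - 1 - z) * option_gamma \<kappa> t K (k - 1))
    (put_ext \<kappa> t K z - put \<kappa> t K b + put_delta \<kappa> t K b * (b - z))"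
proof -
  \<comment> \<open>The weight \<open>max 0 (k - 1 - z)\<close> vanishes below 1 + z and gammas are
    integrated over k > 1, so the effective range starts at 1 + max 0 z; on it the weight is
    linear.\<close>
  define a where "a = max 0 z"
  define h where "h k = (k - 1 - z) * (partial_mean_deriv (K / (k - 1)) * (K / (k - 1)\<^sup>2))" for k
  \<comment> \<open>Integration by parts: an antiderivative of the weight times gamma.\<close>
  define \<Psi> where "\<Psi> k = (k - 1 - z) * delta_ext \<kappa> t K (k - 1) - put_ext \<kappa> t K (k - 1)" for k
  have a: "0 \<le> a" "z \<le> a" "a \<le> b"
    using assms by (auto simp: a_def)
  have "continuous_on {1 + a..1 + b} \<Psi>"
    unfolding \<Psi>_def
    by (intro continuous_intros continuous_on_compose2[OF delta_ext_continuous]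
        continuous_on_compose2[OF put_ext_continuous] assms) (use a in auto)
  moreover have "(\<Psi> has_vector_derivative h k) (at k)" if "k \<in> {1 + a<..<1 + b}" for k
  proof -
    have k: "0 < k - 1" using that a by auto
    have shift: "((\<lambda>k. k - 1) has_real_derivative 1) (at k)"
      by (auto intro!: derivative_eq_intros)
    have 1: "((\<lambda>k. delta_ext \<kappa> t K (k - 1)) has_real_derivative option_gamma \<kappa> t K (k - 1) * 1) (at k)"
      by (rule DERIV_chain2[OF delta_ext_has_deriv[OF k] shift])
    have 2: "((\<lambda>k. put_ext \<kappa> t K (k - 1)) has_real_derivative delta_ext \<kappa> t K (k - 1) * 1) (at k)"
      by (rule DERIV_chain2[OF put_ext_has_deriv[OF k] shift])
    have "(\<Psi> has_real_derivative h k) (at k)"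
      unfolding \<Psi>_def[abs_def]
      by (rule derivative_eq_intros 1 2 refl)+ (simp add: h_def option_gamma_eq[OF k])
    then show ?thesis by (simp add: has_real_derivative_iff_has_vector_derivative)
  qed
  ultimately have int: "(h has_integral \<Psi> (1 + b) - \<Psi> (1 + a)) {1 + a..1 + b}"
    using a by (intro fundamental_theorem_of_calculus_interior) auto
  have nonneg: "0 \<le> h k" if "k \<in> {1 + a..1 + b}" for k
    unfolding h_def using that a assms by (intro mult_nonneg_nonneg partial_mean_deriv_nonneg) auto
  have nonneg_ind: "0 \<le> indicator {1 + a..1 + b} k * h k" for k
    using nonneg[of k] by (auto split: split_indicator)
  have "\<Psi> (1 + b) = (b - z) * put_delta \<kappa> t K b - put \<kappa> t K b"
    using assms by (simp add: \<Psi>_def delta_ext_def put_ext_def)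
  \<comment> \<open>For z > 0 the first term of \<open>\<Psi>\<close> vanishes at 1 + z. For z <= 0
    the endpoint is k = 1, where delta -1 and put value K give z - K, which is again minus the
    continued put.\<close>
  moreover have "\<Psi> (1 + a) = - put_ext \<kappa> t K z"
    by (cases "0 < z") (auto simp: \<Psi>_def a_def delta_ext_def put_ext_def)
  ultimately have val: "\<Psi> (1 + b) - \<Psi> (1 + a) = put_ext \<kappa> t K z - put \<kappa> t K b + put_delta \<kappa> t K b * (b - z)"
    by simp
  have "has_bochner_integral lborel (\<lambda>k. indicator {1 + a..1 + b} k * h k) (\<Psi> (1 + b) - \<Psi> (1 + a))"
  proof (rule has_bochner_integral_nn_integral)
    show "(\<lambda>k. indicator {1 + a..1 + b} k * h k) \<in> borel_measurable lborel"
      unfolding h_def by measurable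
    show "0 \<le> \<Psi> (1 + b) - \<Psi> (1 + a)"
      using int nonneg by (rule has_integral_nonneg)
    show "(\<integral>\<^sup>+ k. ennreal (indicator {1 + a..1 + b} k * h k) \<partial>lborel) = ennreal (\<Psi> (1 + b) - \<Psi> (1 + a))"
      using nn_integral_has_integral_lebesgue[OF nonneg int] by simp
  qed (use nonneg_ind in auto)
  moreover have "indicator {1 + a..1 + b} k * h k =
      indicator {1<..1 + b} k *\<^sub>R (max 0 (k - 1 - z) * option_gamma \<kappa> t K (k - 1))" for k
  proof (cases "1 < k")
    case True
    then show ?thesis
      by (auto simp: a_def h_def option_gamma_eq split: split_indicator)
  next
    \<comment> \<open>Only k = 1 is at stake, since 1 + a >= 1. There K / (k - 1) is K / 0 = 0 and
      \<open>partial_mean_deriv 0\<close> is 0, so the closed interval may be exchanged for the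
      half-open one.\<close>
    case False
    then show ?thesis
      using a by (auto simp: h_def partial_mean_deriv_def split: split_indicator)
  qed
  ultimately show ?thesis
    by (subst has_bochner_integral_restrict_space) (auto simp: val)
qed

text \<open>For k > 1 the weights belonging to z = -1 and z = 0 are k and k - 1, with difference 1;
  the mass is thus a difference of two moments. It is 1 + delta because the continued delta is -1 at
  price 0.\<close>

lemma gamma_mass:
  assumes "0 < K" "0 < b"
  shows "has_bochner_integral (restrict_space lborel {1<..1 + b})
    (\<lambda>k. option_gamma \<kappa> t K (k - 1)) (1 + put_delta \<kappa> t K b)"
proof -
  let ?m = "restrict_space lborel {1<..1 + b}"
  have "has_bochner_integral ?m
     (\<lambda>k. max 0 (k - 1 - (- 1)) * option_gamma \<kappa> t K (k - 1) - max 0 (k - 1 - 0) * option_gamma \<kappa> t K (k - 1))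
     ((put_ext \<kappa> t K (- 1) - put \<kappa> t K b + put_delta \<kappa> t K b * (b - (- 1)))
      - (put_ext \<kappa> t K 0 - put \<kappa> t K b + put_delta \<kappa> t K b * (b - 0)))"
    using assms by (intro has_bochner_integral_diff gamma_moment) auto
  also have "(put_ext \<kappa> t K (- 1) - put \<kappa> t K b + put_delta \<kappa> t K b * (b - (- 1)))
      - (put_ext \<kappa> t K 0 - put \<kappa> t K b + put_delta \<kappa> t K b * (b - 0)) = 1 + put_delta \<kappa> t K b"
    by (simp add: put_ext_def algebra_simps)
  finally show ?thesis
    by (rule has_bochner_integral_cong[OF refl _ refl, THEN iffD1, rotated])
      (auto simp: space_restrict_space algebra_simps)
qed

text \<open>On the range of integration the weight is at most b + |z|, and the gamma has mass at
  most 1. The bound does not involve K, which is what permits integration over strikes.\<close>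

lemma gamma_moment_bounds:
  assumes "0 < K" "0 < b" "z \<le> b"
  defines "T \<equiv> put_ext \<kappa> t K z - put \<kappa> t K b + put_delta \<kappa> t K b * (b - z)"
  shows "0 \<le> T" "T \<le> b + \<bar>z\<bar>"
proof -
  let ?m = "restrict_space lborel {1<..1 + b}"
  note moment = gamma_moment[OF assms(1-3), folded T_def]
  note mass = gamma_mass[OF assms(1,2)]
  have T: "T = (\<integral>k. max 0 (k - 1 - z) * option_gamma \<kappa> t K (k - 1) \<partial>?m)"
    using moment by (simp add: has_bochner_integral_integral_eq)
  have nonneg: "0 \<le> option_gamma \<kappa> t K (k - 1)" if "k \<in> space ?m" for k
    using that assms by (intro option_gamma_nonneg) (auto simp: space_restrict_space)
  show "0 \<le> T"
    unfolding T by (intro Bochner_Integration.integral_nonneg) (auto intro!: mult_nonneg_nonneg nonneg)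
  have "T \<le> (\<integral>k. (b + \<bar>z\<bar>) * option_gamma \<kappa> t K (k - 1) \<partial>?m)"
    unfolding T
  proof (rule integral_mono)
    fix k assume k: "k \<in> space ?m"
    have "max 0 (k - 1 - z) \<le> b + \<bar>z\<bar>"
      using k assms(2) by (auto simp: space_restrict_space)
    then show "max 0 (k - 1 - z) * option_gamma \<kappa> t K (k - 1) \<le> (b + \<bar>z\<bar>) * option_gamma \<kappa> t K (k - 1)"
      by (intro mult_right_mono nonneg k)
  qed (use moment mass in \<open>auto simp: has_bochner_integral_iff\<close>)
  also have "\<dots> = (b + \<bar>z\<bar>) * (1 + put_delta \<kappa> t K b)"
    using mass by (simp add: has_bochner_integral_iff)
  also have "\<dots> \<le> (b + \<bar>z\<bar>) * 1"
    using assms(2) put_delta_bounds[of b K] by (intro mult_left_mono) auto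
  finally show "T \<le> b + \<bar>z\<bar>" by simp
qed

text \<open>Taylor's formula of each put, integrated over the strikes. The strike measure
  \<open>m'\<close> is abstract so that Lebesgue measure on an interval and the Dirac measure of the
  last date are treated alike.\<close>

lemma gamma_mixture:
  assumes "sigma_finite_measure m'" and id [measurable]: "(\<lambda>k. k) \<in> borel_measurable m'"
    and pos: "AE k in m'. 0 < k" and g: "integrable m' g" and "0 < b" "z \<le> b"
  defines "m \<equiv> restrict_space lborel {1<..1 + b}"
    and "T \<equiv> \<lambda>K. put_ext \<kappa> t K z - put \<kappa> t K b + put_delta \<kappa> t K b * (b - z)"
  shows "has_bochner_integral m
    (\<lambda>k. max 0 (k - 1 - z) * (\<integral>k'. option_gamma \<kappa> t k' (k - 1) * g k' \<partial>m'))
    (\<integral>k'. T k' * g k' \<partial>m')"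
proof -
  interpret m': sigma_finite_measure m' by fact
  interpret m: sigma_finite_measure m
    unfolding m_def by (intro sigma_finite_measure_restrict_space sigma_finite_lborel) auto
  interpret pair_sigma_finite m' m ..
  have [measurable]: "g \<in> borel_measurable m'" using g by simp
  have [measurable]: "(\<lambda>k. k) \<in> borel_measurable m"
    unfolding m_def by (rule measurable_restrict_space1) simp
  have space_m: "1 < k" if "k \<in> space m" for k
    using that by (simp add: m_def space_restrict_space)
  define f where "f = (\<lambda>(k', k). max 0 (k - 1 - z) * (option_gamma \<kappa> t k' (k - 1) * g k'))"
  \<comment> \<open>Joint measurability of gamma in strike and price is visible in its explicit
    form, which is valid at positive prices k - 1, hence on all of \<open>space m\<close>.\<close>
  have "(\<lambda>(k', k). max 0 (k - 1 - z) *
        (partial_mean_deriv (k' / (k - 1)) * (k' / (k - 1)\<^sup>2) * g k')) \<in> borel_measurable (m' \<Otimes>\<^sub>M m)"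
    by measurable
  then have f_meas [measurable]: "f \<in> borel_measurable (m' \<Otimes>\<^sub>M m)"
    by (rule measurable_cong[THEN iffD1, rotated])
      (auto simp: f_def space_pair_measure option_gamma_eq dest: space_m)
  have f_int: "has_bochner_integral m (\<lambda>k. f (k', k)) (T k' * g k')" if "0 < k'" for k'
    using has_bochner_integral_mult_left[OF gamma_moment[OF that assms(5,6)], of "g k'"]
    by (simp add: f_def T_def m_def mult.assoc)
  have f_norm: "(\<integral>k. norm (f (k', k)) \<partial>m) = T k' * \<bar>g k'\<bar>" if "0 < k'" for k'
  proof -
    have "has_bochner_integral m
        (\<lambda>k. max 0 (k - 1 - z) * option_gamma \<kappa> t k' (k - 1) * \<bar>g k'\<bar>) (T k' * \<bar>g k'\<bar>)"
      using has_bochner_integral_mult_left[OF gamma_moment[OF that assms(5,6)], of "\<bar>g k'\<bar>"]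
      by (simp add: T_def m_def)
    moreover have "norm (f (k', k)) = max 0 (k - 1 - z) * option_gamma \<kappa> t k' (k - 1) * \<bar>g k'\<bar>"
      if "k \<in> space m" for k
      using option_gamma_nonneg[OF \<open>0 < k'\<close>, of "k - 1"] space_m[OF that] by (simp add: f_def abs_mult)
    ultimately show ?thesis
      by (subst Bochner_Integration.integral_cong[OF refl]) (auto simp: has_bochner_integral_iff)
  qed
  have "integrable (m' \<Otimes>\<^sub>M m) f"
  proof (rule Fubini_integrable[OF f_meas])
    show "integrable m' (\<lambda>k'. \<integral>k. norm (f (k', k)) \<partial>m)"
    proof (rule Bochner_Integration.integrable_bound)
      show "integrable m' (\<lambda>k'. (b + \<bar>z\<bar>) * g k')" using g by simp
      show "AE k' in m'. norm (\<integral>k. norm (f (k', k)) \<partial>m) \<le> norm ((b + \<bar>z\<bar>) * g k')"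
        using pos
      proof eventually_elim
        case (elim k')
        have "0 \<le> T k'" "T k' \<le> b + \<bar>z\<bar>"
          unfolding T_def using gamma_moment_bounds[OF elim assms(5,6)] by auto
        then show ?case
          unfolding f_norm[OF elim] using assms(5) by (simp add: abs_mult mult_right_mono)
      qed
    qed measurable
    show "AE k' in m'. integrable m (\<lambda>k. f (k', k))"
      using pos by eventually_elim (use f_int in \<open>auto simp: has_bochner_integral_iff\<close>)
  qed
  then have int: "integrable (m' \<Otimes>\<^sub>M m) (case_prod (\<lambda>k' k. f (k', k)))"
    by simp
  have eq: "(\<integral>k'. f (k', k) \<partial>m') = max 0 (k - 1 - z) * (\<integral>k'. option_gamma \<kappa> t k' (k - 1) * g k' \<partial>m')" for k
    by (simp add: f_def)
  have "(\<integral>k. (\<integral>k'. f (k', k) \<partial>m') \<partial>m) = (\<integral>k'. (\<integral>k. f (k', k) \<partial>m) \<partial>m')"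
    using integral_fst[OF int] integral_snd[OF int] by simp
  also have "\<dots> = (\<integral>k'. T k' * g k' \<partial>m')"
  proof (rule integral_cong_AE)
    show "AE k' in m'. (\<integral>k. f (k', k) \<partial>m) = T k' * g k'"
      using pos by eventually_elim (use f_int in \<open>auto simp: has_bochner_integral_iff\<close>)
    note put_ext_measurable [measurable] put_measurable[OF assms(5), measurable]
      put_delta_measurable[OF assms(5), measurable]
    show "(\<lambda>k'. T k' * g k') \<in> borel_measurable m'"
      unfolding T_def by measurable
  qed measurable
  finally show ?thesis
    using integrable_snd[OF int] by (simp add: has_bochner_integral_iff eq)
qed

end

section \<open>The static hedge\<close>

locale rollup =
  fixes \<kappa> :: "nat \<Rightarrow> real \<Rightarrow> real measure" and N :: nat and r :: real
  assumes period: "t < N \<Longrightarrow> scaling_period \<kappa> t"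
    and rate: "- 1 < r"
begin

abbreviation "A \<equiv> guarantee_base N r"
abbreviation "\<alpha> \<equiv> hedge_alpha \<kappa> N r"
abbreviation "\<beta> \<equiv> hedge_beta \<kappa> N r"
abbreviation "g \<equiv> hedge_g \<kappa> N r"
abbreviation "m \<equiv> hedge_measure N r"

text \<open>
  The hedge value at withdrawal level 1, continued to fund values \<open>z \<le> 0\<close>; the call appears
  through put-call parity.
\<close>

definition unit_value :: "nat \<Rightarrow> real \<Rightarrow> real" where
  "unit_value t z = \<alpha> t * (1 + 1 / A (t + 1) * (put_ext \<kappa> t (1 + A (t + 1)) z - (1 + A (t + 1)) + z))
     - \<beta> t * put_ext \<kappa> t (1 + A (t + 1)) z + (\<integral>k. put_ext \<kappa> t k z * g t k \<partial>m t)"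

text \<open>
  The payoff at time \<open>t + 1\<close> of the portfolio bought at time \<open>t\<close>, where \<open>v\<close> is the fund value
  before the withdrawal.
\<close>

definition payoff :: "nat \<Rightarrow> real \<Rightarrow> real \<Rightarrow> real" where
  "payoff t w v = \<alpha> t * (w + 1 / A (t + 1) * max 0 (v - w * (1 + A (t + 1))))
     - \<beta> t * max 0 (w * (1 + A (t + 1)) - v) + (\<integral>k. max 0 (w * k - v) * g t k \<partial>m t)"

lemma base_pos: "0 < A t" if "t < N"
  unfolding guarantee_base_def using that rate by (intro sum_pos) auto

text \<open>This includes time N, where the empty sum gives 0 in place of infinity: the strike
  \<open>1 + A N\<close> is then 1, and it enters only next to the zero coefficients of time N -
  1.\<close>

lemma base_nonneg: "0 \<le> A t"
  unfolding guarantee_base_def using rate by (intro sum_nonneg) auto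

lemma hedge_measure_last: "m t = return borel 1" if "t + 1 = N"
  using that by (simp add: hedge_measure_def)

lemma hedge_measure_step: "m t = restrict_space lborel {1<..1 + A (t + 1)}" if "t + 1 < N"
  using that by (simp add: hedge_measure_def)

lemma hedge_measure_sigma_finite: "sigma_finite_measure (m t)"
proof (cases "t + 1 = N")
  case True
  interpret prob_space "return borel (1 :: real)" by (rule prob_space_return) simp
  show ?thesis unfolding hedge_measure_last[OF True] by unfold_locales
next
  case False
  then show ?thesis
    by (auto simp: hedge_measure_def intro!: sigma_finite_measure_restrict_space sigma_finite_lborel)
qed

lemma hedge_measure_measurable: "f \<in> borel_measurable borel \<Longrightarrow> f \<in> borel_measurable (m t)"
  by (cases "t + 1 = N")
    (auto simp: hedge_measure_def cong: measurable_cong_sets intro!: measurable_restrict_space1)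

lemma hedge_measure_support: "AE k in m t. 1 \<le> k \<and> k \<le> 1 + A (t + 1)"
proof (cases "t + 1 = N")
  case True
  show ?thesis
    unfolding hedge_measure_last[OF True] using base_nonneg[of "t + 1"] by (subst AE_return) auto
next
  case False
  show ?thesis
    by (rule AE_I2) (use False in \<open>auto simp: hedge_measure_def space_restrict_space\<close>)
qed

lemma hedge_last: "\<alpha> t = 0" "\<beta> t = 0" "g t k = 1" if "t + 1 = N"
proof -
  have "N \<le> t + 1" using that by simp
  then show "\<alpha> t = 0" "\<beta> t = 0" "g t k = 1"
    by (subst hedge_alpha.simps hedge_beta.simps hedge_g.simps, simp only: if_True)+
qed

lemma call_homogeneous:
  "call \<kappa> t (a * K) (a * s) = a * call \<kappa> t K s" if "t < N" "0 < a" "0 < s"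
proof -
  interpret scaling_period \<kappa> t by (rule period) fact
  show ?thesis using that put_homogeneous[of s a K] by (simp add: call_eq algebra_simps)
qed

text \<open>This allows normalizing the withdrawal level to 1, and it turns a state reached by a
  reset, where fund value and level stand in the fixed ratio of the guarantee base, into a multiple
  of a single value.\<close>

lemma hedge_value_homogeneous:
  assumes "t < N" "0 < a" "0 < x"
  shows "hedge_value \<kappa> N r t (a * w) (a * x) = a * hedge_value \<kappa> N r t w x"
proof -
  interpret scaling_period \<kappa> t by (rule period) fact
  have put: "put \<kappa> t (a * w * k) (a * x) = a * put \<kappa> t (w * k) x" for k
    using put_homogeneous[of x a "w * k"] assms by (simp add: mult.assoc)
  have call: "call \<kappa> t (a * w * k) (a * x) = a * call \<kappa> t (w * k) x" for k
    using call_homogeneous[of t a x "w * k"] assms by (simp add: mult.assoc)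
  show ?thesis
    unfolding hedge_value_def Let_def put call
    by (simp add: algebra_simps)
qed

lemma unit_value_eq_hedge_value:
  assumes "t < N" "0 < z"
  shows "unit_value t z = hedge_value \<kappa> N r t 1 z"
proof -
  interpret scaling_period \<kappa> t by (rule period) fact
  show ?thesis
    using assms by (simp add: unit_value_def hedge_value_def Let_def put_ext_def call_eq algebra_simps)
qed

section \<open>Taylor expansion of the hedge value\<close>

lemma integrable_put_hedge:
  assumes "t < N" and g: "integrable (m t) (g t)"
  shows "integrable (m t) (\<lambda>k. put_ext \<kappa> t k z * g t k)"
    and "0 < s \<Longrightarrow> integrable (m t) (\<lambda>k. put \<kappa> t k s * g t k)"
    and "0 < s \<Longrightarrow> integrable (m t) (\<lambda>k. put_delta \<kappa> t k s * g t k)"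
proof -
  interpret scaling_period \<kappa> t by (rule period) fact
  show "integrable (m t) (\<lambda>k. put_ext \<kappa> t k z * g t k)"
  proof (rule integrable_bounded_mult[OF g])
    show "(\<lambda>k. put_ext \<kappa> t k z) \<in> borel_measurable (m t)"
      by (intro hedge_measure_measurable put_ext_measurable)
    show "AE k in m t. \<bar>put_ext \<kappa> t k z\<bar> \<le> 1 + A (t + 1) + \<bar>z\<bar>"
      using hedge_measure_support
    proof eventually_elim
      case (elim k)
      then show ?case using put_ext_bound[of k z] by linarith
    qed
  qed
  show "integrable (m t) (\<lambda>k. put \<kappa> t k s * g t k)" if "0 < s"
  proof (rule integrable_bounded_mult[OF g])
    show "(\<lambda>k. put \<kappa> t k s) \<in> borel_measurable (m t)"
      by (intro hedge_measure_measurable put_measurable that)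
    show "AE k in m t. \<bar>put \<kappa> t k s\<bar> \<le> 1 + A (t + 1)"
      using hedge_measure_support
    proof eventually_elim
      case (elim k)
      then show ?case using put_bounds[OF that, of k] by linarith
    qed
  qed
  show "integrable (m t) (\<lambda>k. put_delta \<kappa> t k s * g t k)" if "0 < s"
  proof (rule integrable_bounded_mult[OF g])
    show "(\<lambda>k. put_delta \<kappa> t k s) \<in> borel_measurable (m t)"
      by (intro hedge_measure_measurable put_delta_measurable that)
    show "AE k in m t. \<bar>put_delta \<kappa> t k s\<bar> \<le> 1"
      using put_delta_bounds[OF that] by (auto simp: abs_le_iff)
  qed
qed

text \<open>Taylor's formula for \<open>unit_value (t + 1)\<close> around \<open>A (t + 1)\<close>:
  \<open>\<alpha> t\<close> is the value there, \<open>\<beta> t\<close> the slope and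
  \<open>g t\<close> the second derivative. The call and the put at strike
  \<open>1 + A (t + 2)\<close> are expanded by \<open>gamma_moment\<close>, the strike mixture by
  \<open>gamma_mixture\<close>.\<close>

lemma hedge_moment:
  assumes t: "t + 1 < N" and g: "integrable (m (t + 1)) (g (t + 1))" and z: "z \<le> A (t + 1)"
  shows "has_bochner_integral (m t) (\<lambda>k. max 0 (k - 1 - z) * g t k)
    (unit_value (t + 1) z - \<alpha> t + \<beta> t * (A (t + 1) - z))"
proof -
  interpret scaling_period \<kappa> "t + 1" by (rule period) fact
  define b where "b = A (t + 1)"
  define K where "K = 1 + A (t + 2)"
  \<comment> \<open>Call and put with the same strike share their gamma by parity, so only this
    combination of coefficients is seen by the remainder.\<close>
  define c where "c = \<alpha> (t + 1) / A (t + 2) - \<beta> (t + 1)"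
  define T where "T k = put_ext \<kappa> (t + 1) k z - put \<kappa> (t + 1) k b + put_delta \<kappa> (t + 1) k b * (b - z)" for k
  have b: "0 < b" "z \<le> b" using base_pos[of "t + 1"] t z by (auto simp: b_def)
  have K: "0 < K" using base_nonneg[of "t + 2"] by (simp add: K_def)
  have pos: "AE k in m (t + 1). 0 < k"
    using hedge_measure_support[of "t + 1"] by eventually_elim simp
  note int = integrable_put_hedge[OF t g]
  define I1 where "I1 = (\<integral>k. put_ext \<kappa> (t + 1) k z * g (t + 1) k \<partial>m (t + 1))"
  define I2 where "I2 = (\<integral>k. put \<kappa> (t + 1) k b * g (t + 1) k \<partial>m (t + 1))"
  define I3 where "I3 = (\<integral>k. put_delta \<kappa> (t + 1) k b * g (t + 1) k \<partial>m (t + 1))"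
  define q where "q = 1 / A (t + 2)"
  have "has_bochner_integral (m t)
      (\<lambda>k. c * (max 0 (k - 1 - z) * option_gamma \<kappa> (t + 1) K (k - 1))
         + max 0 (k - 1 - z) * (\<integral>k'. option_gamma \<kappa> (t + 1) k' (k - 1) * g (t + 1) k' \<partial>m (t + 1)))
      (c * T K + (\<integral>k'. T k' * g (t + 1) k' \<partial>m (t + 1)))"
    unfolding hedge_measure_step[OF t] T_def b_def[symmetric]
    by (intro has_bochner_integral_add has_bochner_integral_mult_right gamma_moment gamma_mixture
        hedge_measure_sigma_finite hedge_measure_measurable pos g b K) simp
  moreover have "max 0 (k - 1 - z) * g t k = c * (max 0 (k - 1 - z) * option_gamma \<kappa> (t + 1) K (k - 1))
         + max 0 (k - 1 - z) * (\<integral>k'. option_gamma \<kappa> (t + 1) k' (k - 1) * g (t + 1) k' \<partial>m (t + 1))" for k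
  proof -
    have "g t k = c * option_gamma \<kappa> (t + 1) K (k - 1)
        + (\<integral>k'. option_gamma \<kappa> (t + 1) k' (k - 1) * g (t + 1) k' \<partial>m (t + 1))"
      using t by (subst hedge_g.simps) (simp add: Let_def c_def K_def)
    then show ?thesis by (simp only: distrib_left mult.left_commute)
  qed
  moreover have "c * T K + (\<integral>k'. T k' * g (t + 1) k' \<partial>m (t + 1))
      = unit_value (t + 1) z - \<alpha> t + \<beta> t * (b - z)"
  proof -
    have "(\<lambda>k. T k * g (t + 1) k) = (\<lambda>k. put_ext \<kappa> (t + 1) k z * g (t + 1) k - put \<kappa> (t + 1) k b * g (t + 1) k
        + (b - z) * (put_delta \<kappa> (t + 1) k b * g (t + 1) k))"
      by (auto simp: T_def algebra_simps)
    then have 1: "(\<integral>k'. T k' * g (t + 1) k' \<partial>m (t + 1)) = I1 - I2 + (b - z) * I3"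
      using int[of z] int[of b] b by (simp add: I1_def I2_def I3_def)
    have 2: "\<alpha> t = \<alpha> (t + 1) * (1 + q * (b - K + put \<kappa> (t + 1) K b)) - \<beta> (t + 1) * put \<kappa> (t + 1) K b + I2"
      using t call_eq[OF b(1), of K] by (subst hedge_alpha.simps) (simp add: Let_def K_def b_def q_def I2_def)
    have 3: "\<beta> t = \<alpha> (t + 1) * q * (1 + put_delta \<kappa> (t + 1) K b) - \<beta> (t + 1) * put_delta \<kappa> (t + 1) K b + I3"
      using t call_delta_eq[OF b(1), of K]
      by (subst hedge_beta.simps) (simp add: Let_def K_def b_def q_def I3_def)
    have 4: "unit_value (t + 1) z = \<alpha> (t + 1) * (1 + q * (put_ext \<kappa> (t + 1) K z - K + z))
        - \<beta> (t + 1) * put_ext \<kappa> (t + 1) K z + I1"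
      by (simp add: unit_value_def K_def q_def I1_def)
    have 5: "c = \<alpha> (t + 1) * q - \<beta> (t + 1)"
      by (simp add: c_def q_def)
    show ?thesis
      unfolding 1 2 3 4 5 unfolding T_def by algebra
  qed
  ultimately show ?thesis
    by (simp only: b_def)
qed

text \<open>As for the mass of a gamma: the moments at -1 and 0 are integrable and their weights
  differ by 1 on k > 1. No sign of \<open>g t\<close> is used.\<close>

lemma hedge_density_integrable_step:
  assumes t: "t + 1 < N" and g: "integrable (m (t + 1)) (g (t + 1))"
  shows "integrable (m t) (g t)"
proof -
  have "0 < A (t + 1)" using base_pos t by simp
  then have "integrable (m t) (\<lambda>k. max 0 (k - 1 - (- 1)) * g t k - max 0 (k - 1 - 0) * g t k)"
    using hedge_moment[OF t g, of "- 1"] hedge_moment[OF t g, of 0]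
    by (intro Bochner_Integration.integrable_diff) (auto simp: has_bochner_integral_iff)
  then show ?thesis
    by (rule Bochner_Integration.integrable_cong[OF refl, THEN iffD1, rotated])
      (use t in \<open>auto simp: hedge_measure_step space_restrict_space algebra_simps\<close>)
qed

lemma hedge_density_integrable: "t < N \<Longrightarrow> integrable (m t) (g t)"
proof (induction "N - t" arbitrary: t)
  case (Suc n)
  show ?case
  proof (cases "t + 1 = N")
    case True
    interpret prob_space "return borel (1 :: real)" by (rule prob_space_return) simp
    have "g t = (\<lambda>_. 1)" using True by (simp add: hedge_last fun_eq_iff)
    then show ?thesis unfolding hedge_measure_last[OF True] by simp
  next
    case False
    then have t: "t + 1 < N" using Suc.prems by simp
    have "n = N - (t + 1)" using Suc.hyps(2) by arith
    then have "integrable (m (t + 1)) (g (t + 1))" using t by (rule Suc.hyps(1))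
    with t show ?thesis by (rule hedge_density_integrable_step)
  qed
qed simp

text \<open>For z <= 0 every continued put is k - z = (k - 1) - (z - 1), so the mixture is the
  moment at z - 1, that is, the Taylor formula one date later with one more withdrawal taken out.
  The terms in \<open>\<alpha> t\<close> and \<open>\<beta> t\<close> cancel, and each remaining
  date contributes 1.\<close>

lemma unit_value_depleted:
  "t < N \<Longrightarrow> z \<le> 0 \<Longrightarrow> unit_value t z = real (N - t) - z"
proof (induction "N - t" arbitrary: t z)
  case (Suc n)
  interpret scaling_period \<kappa> t by (rule period) fact
  have ext: "put_ext \<kappa> t k z = k - z" for k using Suc.prems by (simp add: put_ext_def)
  show ?case
  proof (cases "t + 1 = N")
    case True
    then have "N - t = 1" by simp
    with True show ?thesis
      by (simp add: unit_value_def hedge_last hedge_measure_last ext integral_return)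
  next
    case False
    then have t: "t + 1 < N" using Suc.prems by simp
    have A: "0 < A (t + 1)" using base_pos t by simp
    have "(\<integral>k. put_ext \<kappa> t k z * g t k \<partial>m t) = (\<integral>k. max 0 (k - 1 - (z - 1)) * g t k \<partial>m t)"
      using Suc.prems t
      by (intro Bochner_Integration.integral_cong)
        (auto simp: ext hedge_measure_step space_restrict_space)
    also have "\<dots> = unit_value (t + 1) (z - 1) - \<alpha> t + \<beta> t * (A (t + 1) - (z - 1))"
      using hedge_moment[OF t hedge_density_integrable[OF t], of "z - 1"] A Suc.prems
      by (simp add: has_bochner_integral_iff)
    also have "unit_value (t + 1) (z - 1) = real (N - (t + 1)) - (z - 1)"
      using Suc t by (intro Suc.hyps) auto
    finally show ?thesis
      using t by (simp add: unit_value_def ext algebra_simps of_nat_diff)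
  qed
qed simp

section \<open>The payoff of the hedge portfolio after one period\<close>

lemma payoff_last: "payoff t w v = max 0 (w - v)" if "t + 1 = N"
  unfolding payoff_def hedge_last[OF that] hedge_measure_last[OF that]
  by (simp add: integral_return)

text \<open>
  No sign condition on \<open>v\<close> is imposed, so that the integrands in \<open>kernel_value\<close> can be rewritten
  pointwise, including the null set of nonpositive prices, where measurability would otherwise
  be unclear.
\<close>

lemma payoff_step:
  assumes t: "t + 1 < N" and w: "0 < w"
  shows "payoff t w v = (if v - w \<le> 0 then real (N - t - 1) * w - (v - w)
    else hedge_value \<kappa> N r (t + 1) (max w ((v - w) / A (t + 1))) (v - w))"
proof -
  define b where "b = A (t + 1)"
  \<comment> \<open>The next fund value per unit of the current withdrawal level; the level is
    raised exactly when z exceeds b.\<close>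
  define z where "z = (v - w) / w"
  have b: "0 < b" using base_pos[of "t + 1"] t by (simp add: b_def)
  have v: "v = w * (1 + z)" using w by (simp add: z_def field_simps)
  have scale: "max 0 (w * c) = w * max 0 c" for c
    using w by (simp add: max_mult_distrib_left)
  have 1: "max 0 (w * k - v) = w * max 0 (k - 1 - z)" for k
    using scale[of "k - 1 - z"] by (simp add: v algebra_simps)
  have 2: "max 0 (w * (1 + b) - v) = w * max 0 (b - z)"
    using scale[of "b - z"] by (simp add: v algebra_simps)
  have 3: "max 0 (v - w * (1 + b)) = w * max 0 (z - b)"
    using scale[of "z - b"] by (simp add: v algebra_simps)
  have payoff: "payoff t w v = w * (\<alpha> t * (1 + 1 / b * max 0 (z - b)) - \<beta> t * max 0 (b - z)
      + (\<integral>k. max 0 (k - 1 - z) * g t k \<partial>m t))"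
    unfolding payoff_def b_def[symmetric] 1 2 3
    by (simp add: algebra_simps)
  note moment = hedge_moment[OF t hedge_density_integrable[OF t], folded b_def]
  \<comment> \<open>At z = b no put of the mixture is in the money, since its strikes satisfy k - 1
    <= b, and \<open>hedge_moment\<close> reduces to the constant \<open>\<alpha> t\<close>.\<close>
  have \<alpha>: "\<alpha> t = hedge_value \<kappa> N r (t + 1) 1 b"
  proof -
    have "(\<integral>k. max 0 (k - 1 - b) * g t k \<partial>m t) = 0"
      using t by (intro Bochner_Integration.integral_eq_zero_AE AE_I2)
        (auto simp: hedge_measure_step space_restrict_space b_def)
    then have "unit_value (t + 1) b = \<alpha> t"
      using moment[of b] by (simp add: has_bochner_integral_iff)
    then show ?thesis
      using unit_value_eq_hedge_value[OF t b] by simp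
  qed
  have y: "v - w = w * z" using w by (simp add: z_def)
  show ?thesis
  proof (cases "z \<le> b")
    case True
    then have "payoff t w v = w * unit_value (t + 1) z"
      using moment[OF True] by (simp add: payoff has_bochner_integral_iff)
    also have "\<dots> = (if v - w \<le> 0 then real (N - t - 1) * w - (v - w)
        else hedge_value \<kappa> N r (t + 1) (max w ((v - w) / b)) (v - w))"
    proof (cases "z \<le> 0")
      case True
      then show ?thesis
        using w unfolding unit_value_depleted[OF t True] by (simp add: y mult_le_0_iff algebra_simps)
    next
      case z: False
      have "w * z / b \<le> w"
        using True b w by (simp add: divide_le_eq)
      then have "max w (w * z / b) = w * 1" by simp
      then show ?thesis
        using z w unit_value_eq_hedge_value[OF t, of z] hedge_value_homogeneous[OF t w, of z 1]
        by (simp only: y mult_le_0_iff if_False) simp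
    qed
    finally show ?thesis unfolding b_def .
  next
    \<comment> \<open>The reset case. Constant and call add up to \<open>\<alpha> t * z / b\<close>,
      and \<open>\<alpha> t\<close> is the value at level 1 and fund value b; scaling that state by
      w * z / b gives level (v - w) / b and fund value v - w.\<close>
    case False
    have "(\<integral>k. max 0 (k - 1 - z) * g t k \<partial>m t) = 0"
      using t False by (intro Bochner_Integration.integral_eq_zero_AE AE_I2)
        (auto simp: hedge_measure_step space_restrict_space b_def)
    with False have "payoff t w v = w * (\<alpha> t * (1 + 1 / b * (z - b)))"
      by (simp add: payoff)
    also have "\<dots> = w * z / b * \<alpha> t"
      using b by (simp add: field_simps)
    also have "\<dots> = hedge_value \<kappa> N r (t + 1) (w * z / b * 1) (w * z / b * b)"
      using b w False unfolding \<alpha>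
      by (intro hedge_value_homogeneous[OF t, symmetric]) auto
    also have "w * z / b * b = v - w" using b y by simp
    also have "w * z / b * 1 = max w ((v - w) / b)"
      using b w False by (simp add: y max_def field_simps)
    finally show ?thesis
      using False b w by (simp add: b_def y mult_le_0_iff)
  qed
qed

lemma payoff_measurable: "(\<lambda>(w, v). payoff t w v) \<in> borel_measurable (borel \<Otimes>\<^sub>M borel)" if "t < N"
proof -
  interpret sigma_finite_measure "m t" by (rule hedge_measure_sigma_finite)
  have [measurable]: "g t \<in> borel_measurable (m t)" "(\<lambda>k. k) \<in> borel_measurable (m t)"
    using hedge_density_integrable[OF that] by (auto intro: hedge_measure_measurable)
  show ?thesis
    unfolding payoff_def by measurable
qed

lemma payoff_integrand_bound:
  "AE k in m t. \<bar>max 0 (w * k - v)\<bar> \<le> \<bar>w\<bar> * (1 + A (t + 1)) + \<bar>v\<bar>"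
  using hedge_measure_support
proof eventually_elim
  case (elim k)
  have "\<bar>w * k\<bar> \<le> \<bar>w\<bar> * (1 + A (t + 1))"
    using elim by (simp add: abs_mult mult_left_mono)
  then show ?case by linarith
qed

text \<open>Linear growth reduces integrability of the payoff along the process to that of the fund
  and the withdrawal level.\<close>

lemma payoff_growth: "\<exists>C. \<forall>w v. \<bar>payoff t w v\<bar> \<le> C * (\<bar>w\<bar> + \<bar>v\<bar>)" if "t < N"
proof -
  \<comment> \<open>At t = N - 1 this is 0; then 1 / b and (1 + b) / b are both 0, and the estimates
    below remain valid.\<close>
  define b where "b = A (t + 1)"
  have b: "0 \<le> b" using base_nonneg by (simp add: b_def)
  note g = hedge_density_integrable[OF that]
  define I where "I = (\<integral>k. \<bar>g t k\<bar> \<partial>m t)"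
  have I: "0 \<le> I" by (simp add: I_def)
  have tri: "\<bar>p - q + s\<bar> \<le> \<bar>p\<bar> + \<bar>q\<bar> + \<bar>s\<bar>" for p q s :: real
    by linarith
  have lin: "\<bar>w\<bar> * (1 + b) + \<bar>v\<bar> \<le> (1 + b) * (\<bar>w\<bar> + \<bar>v\<bar>)" for w v
    using b by (simp add: algebra_simps)
  have "\<bar>payoff t w v\<bar> \<le> (\<bar>\<alpha> t\<bar> * (1 + (1 + b) / b) + \<bar>\<beta> t\<bar> * (1 + b) + (1 + b) * I) * (\<bar>w\<bar> + \<bar>v\<bar>)" for w v
  proof -
    let ?n = "\<bar>w\<bar> + \<bar>v\<bar>"
    have wb: "\<bar>w * (1 + b)\<bar> = \<bar>w\<bar> * (1 + b)" using b by (simp add: abs_mult)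
    have 1: "\<bar>max 0 (v - w * (1 + b))\<bar> \<le> (1 + b) * ?n" and 2: "\<bar>max 0 (w * (1 + b) - v)\<bar> \<le> (1 + b) * ?n"
      using wb lin[of w v] by linarith+
    have "\<bar>w + 1 / b * max 0 (v - w * (1 + b))\<bar> \<le> \<bar>w\<bar> + 1 / b * ((1 + b) * ?n)"
      using mult_left_mono[OF 1, of "1 / b"] b
      by (intro order_trans[OF abs_triangle_ineq]) (simp add: abs_mult)
    also have "\<dots> \<le> ?n + (1 + b) / b * ?n" by simp
    also have "\<dots> = (1 + (1 + b) / b) * ?n" by (simp only: distrib_right mult_1_left)
    finally have a: "\<bar>\<alpha> t * (w + 1 / b * max 0 (v - w * (1 + b)))\<bar> \<le> \<bar>\<alpha> t\<bar> * ((1 + (1 + b) / b) * ?n)"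
      unfolding abs_mult by (rule mult_left_mono) simp
    have c: "\<bar>\<beta> t * max 0 (w * (1 + b) - v)\<bar> \<le> \<bar>\<beta> t\<bar> * ((1 + b) * ?n)"
      unfolding abs_mult by (rule mult_left_mono[OF 2]) simp
    have "\<bar>\<integral>k. max 0 (w * k - v) * g t k \<partial>m t\<bar> \<le> (\<integral>k. \<bar>max 0 (w * k - v) * g t k\<bar> \<partial>m t)"
      by (rule integral_abs_bound)
    also have "\<dots> \<le> (\<integral>k. (1 + b) * ?n * \<bar>g t k\<bar> \<partial>m t)"
    proof (rule integral_mono_AE)
      show "integrable (m t) (\<lambda>k. \<bar>max 0 (w * k - v) * g t k\<bar>)"
        by (intro integrable_abs integrable_bounded_mult[OF g _ payoff_integrand_bound]
            hedge_measure_measurable) measurable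
      show "AE k in m t. \<bar>max 0 (w * k - v) * g t k\<bar> \<le> (1 + b) * ?n * \<bar>g t k\<bar>"
        using payoff_integrand_bound[of w v t]
      proof eventually_elim
        case (elim k)
        then have "\<bar>max 0 (w * k - v)\<bar> \<le> (1 + b) * ?n"
          using lin[of w v] unfolding b_def by linarith
        then show ?case unfolding abs_mult by (rule mult_right_mono) simp
      qed
    qed (use g in simp)
    also have "\<dots> = (1 + b) * ?n * I" by (simp add: I_def)
    finally have d: "\<bar>\<integral>k. max 0 (w * k - v) * g t k \<partial>m t\<bar> \<le> (1 + b) * ?n * I" .
    have "\<bar>payoff t w v\<bar> \<le> \<bar>\<alpha> t\<bar> * ((1 + (1 + b) / b) * ?n) + \<bar>\<beta> t\<bar> * ((1 + b) * ?n) + (1 + b) * ?n * I"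
      unfolding payoff_def b_def[symmetric] by (intro order_trans[OF tri] add_mono a c d)
    also have "\<dots> = (\<bar>\<alpha> t\<bar> * (1 + (1 + b) / b) + \<bar>\<beta> t\<bar> * (1 + b) + (1 + b) * I) * ?n"
      by algebra
    finally show ?thesis .
  qed
  then show ?thesis by blast
qed

text \<open>Under the return law, x * \<rho> has law \<open>\<kappa> t x\<close>, so each option of
  the portfolio is priced at x. Fubini applies to the mixture because each put is bounded by its
  strike and \<open>g t\<close> is integrable.\<close>

lemma payoff_expectation:
  assumes t: "t < N" and x: "0 < x"
  shows "has_bochner_integral (\<kappa> t 1) (\<lambda>\<rho>. payoff t w (x * \<rho>)) (hedge_value \<kappa> N r t w x)"
proof -
  interpret scaling_period \<kappa> t by (rule period) fact
  interpret m: sigma_finite_measure "m t" by (rule hedge_measure_sigma_finite)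
  interpret P: pair_sigma_finite "m t" "\<kappa> t 1" ..
  note g = hedge_density_integrable[OF t]
  have [measurable]: "g t \<in> borel_measurable (m t)" "(\<lambda>k. k) \<in> borel_measurable (m t)"
    using g by (auto intro: hedge_measure_measurable)
  have call: "has_bochner_integral (\<kappa> t 1) (\<lambda>\<rho>. max 0 (x * \<rho> - K)) (call \<kappa> t K x)" for K
  proof -
    have "integrable (\<kappa> t 1) (\<lambda>\<rho>. x * \<rho> - K + max 0 (K - x * \<rho>))"
      using return_integrable put_integrable[of x K] x by simp
    moreover have "x * \<rho> - K + max 0 (K - x * \<rho>) = max 0 (x * \<rho> - K)" for \<rho> by simp
    ultimately show ?thesis
      unfolding call_def kernel_scale[OF x] by (subst integral_distr) (auto simp: has_bochner_integral_iff)
  qed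
  have put: "has_bochner_integral (\<kappa> t 1) (\<lambda>\<rho>. max 0 (K - x * \<rho>)) (put \<kappa> t K x)" for K
    using put_integrable[of x K] x by (simp add: has_bochner_integral_iff put_eq)
  define f where "f = (\<lambda>(k, \<rho>). max 0 (w * k - x * \<rho>) * g t k)"
  have f_meas [measurable]: "f \<in> borel_measurable (m t \<Otimes>\<^sub>M \<kappa> t 1)"
    unfolding f_def by measurable
  have f_int: "has_bochner_integral (\<kappa> t 1) (\<lambda>\<rho>. f (k, \<rho>)) (put \<kappa> t (w * k) x * g t k)" for k
    unfolding f_def using has_bochner_integral_mult_left[OF put] by simp
  have f_norm: "(\<integral>\<rho>. norm (f (k, \<rho>)) \<partial>\<kappa> t 1) = put \<kappa> t (w * k) x * \<bar>g t k\<bar>" for k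
    using has_bochner_integral_mult_left[OF put[of "w * k"], of "\<bar>g t k\<bar>"]
    by (simp add: f_def abs_mult has_bochner_integral_iff)
  have "integrable (m t \<Otimes>\<^sub>M \<kappa> t 1) f"
  proof (rule P.Fubini_integrable[OF f_meas])
    show "integrable (m t) (\<lambda>k. \<integral>\<rho>. norm (f (k, \<rho>)) \<partial>\<kappa> t 1)"
      unfolding f_norm
    proof (rule integrable_bounded_mult)
      note put_measurable[OF x, measurable]
      show "(\<lambda>k. put \<kappa> t (w * k) x) \<in> borel_measurable (m t)" by measurable
      show "AE k in m t. \<bar>put \<kappa> t (w * k) x\<bar> \<le> \<bar>w\<bar> * (1 + A (t + 1))"
        using hedge_measure_support
      proof eventually_elim
        case (elim k)
        have "\<bar>w * k\<bar> \<le> \<bar>w\<bar> * (1 + A (t + 1))"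
          using elim by (simp add: abs_mult mult_left_mono)
        then show ?case using put_bounds[OF x, of "w * k"] by linarith
      qed
    qed (use g in simp)
    show "AE k in m t. integrable (\<kappa> t 1) (\<lambda>\<rho>. f (k, \<rho>))"
      using f_int by (auto simp: has_bochner_integral_iff)
  qed
  then have int: "integrable (m t \<Otimes>\<^sub>M \<kappa> t 1) (case_prod (\<lambda>k \<rho>. f (k, \<rho>)))" by simp
  have "(\<integral>\<rho>. (\<integral>k. f (k, \<rho>) \<partial>m t) \<partial>\<kappa> t 1) = (\<integral>k. (\<integral>\<rho>. f (k, \<rho>) \<partial>\<kappa> t 1) \<partial>m t)"
    using P.integral_fst[OF int] P.integral_snd[OF int] by simp
  also have "\<dots> = (\<integral>k. put \<kappa> t (w * k) x * g t k \<partial>m t)"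
    using f_int by (simp add: has_bochner_integral_iff)
  finally have "has_bochner_integral (\<kappa> t 1) (\<lambda>\<rho>. \<integral>k. f (k, \<rho>) \<partial>m t) (\<integral>k. put \<kappa> t (w * k) x * g t k \<partial>m t)"
    using P.integrable_snd[OF int] by (simp add: has_bochner_integral_iff)
  moreover have "has_bochner_integral (\<kappa> t 1) (\<lambda>_. w) w"
    by (simp add: has_bochner_integral_iff)
  ultimately have "has_bochner_integral (\<kappa> t 1) (\<lambda>\<rho>. payoff t w (x * \<rho>))
     (\<alpha> t * (w + 1 / A (t + 1) * call \<kappa> t (w * (1 + A (t + 1))) x)
        - \<beta> t * put \<kappa> t (w * (1 + A (t + 1))) x + (\<integral>k. put \<kappa> t (w * k) x * g t k \<partial>m t))"
    unfolding payoff_def f_def prod.case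
    by (intro has_bochner_integral_add has_bochner_integral_diff has_bochner_integral_mult_right call put)
  then show ?thesis
    by (simp add: hedge_value_def Let_def)
qed

section \<open>The backward recursion over the kernels\<close>

lemma kernel_value_eq_hedge_value:
  "t < N \<Longrightarrow> 0 < s \<Longrightarrow> 0 < w \<Longrightarrow> 0 < x \<Longrightarrow> kernel_value \<kappa> N r t s w x = hedge_value \<kappa> N r t w x"
proof (induction "N - t" arbitrary: t s w x)
  case (Suc n)
  interpret scaling_period \<kappa> t by (rule period) fact
  have neg_part: "neg_part (v - w) = max 0 (w - v)" for v
    by (simp add: neg_part_def min_def max_def)
  have "kernel_value \<kappa> N r t s w x = (\<integral>s'. payoff t w (x * (s' / s)) \<partial>\<kappa> t s)"
  proof (subst kernel_value.simps, cases "t + 1 = N")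
    case True
    then show "(if N \<le> t then 0 else \<integral>s'. (let y = x * (s' / s) - w in
        if t + 1 = N then neg_part y
        else if y \<le> 0 then real (N - t - 1) * w - y
        else kernel_value \<kappa> N r (t + 1) s' (max w (y / A (t + 1))) y) \<partial>\<kappa> t s)
      = (\<integral>s'. payoff t w (x * (s' / s)) \<partial>\<kappa> t s)"
      by (simp add: payoff_last neg_part)
  next
    case False
    then have t: "t + 1 < N" using Suc.prems by simp
    \<comment> \<open>A positive next fund value forces s' > 0, as x and s are positive. The
      induction hypothesis therefore applies pointwise, and the integrand is the payoff
      everywhere.\<close>
    have "kernel_value \<kappa> N r (t + 1) s' (max w ((x * (s' / s) - w) / A (t + 1))) (x * (s' / s) - w)
      = hedge_value \<kappa> N r (t + 1) (max w ((x * (s' / s) - w) / A (t + 1))) (x * (s' / s) - w)"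
      if "\<not> x * (s' / s) - w \<le> 0" for s'
    proof (rule Suc.hyps)
      have "0 < x * (s' / s)" using that Suc.prems by linarith
      then show "0 < s'"
        using Suc.prems by (simp add: zero_less_mult_iff zero_less_divide_iff)
    qed (use Suc that t in auto)
    then show "(if N \<le> t then 0 else \<integral>s'. (let y = x * (s' / s) - w in
        if t + 1 = N then neg_part y
        else if y \<le> 0 then real (N - t - 1) * w - y
        else kernel_value \<kappa> N r (t + 1) s' (max w (y / A (t + 1))) y) \<partial>\<kappa> t s)
      = (\<integral>s'. payoff t w (x * (s' / s)) \<partial>\<kappa> t s)"
      using t Suc.prems
      by (auto simp: payoff_step Let_def intro!: Bochner_Integration.integral_cong)
  qed
  \<comment> \<open>Only s' / s enters, and under \<open>\<kappa> t s\<close> this ratio has law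
    \<open>\<kappa> t 1\<close>; this is why the value does not depend on s.\<close>
  also have "\<dots> = (\<integral>\<rho>. payoff t w (x * \<rho>) \<partial>\<kappa> t 1)"
  proof -
    have [measurable]: "(\<lambda>v. payoff t w v) \<in> borel_measurable borel"
      using measurable_compose[OF measurable_Pair1' payoff_measurable[OF Suc.prems(1)], of w] by simp
    show ?thesis
      unfolding kernel_scale[OF Suc.prems(2)] using Suc.prems(2) by (subst integral_distr) auto
  qed
  also have "\<dots> = hedge_value \<kappa> N r t w x"
    using payoff_expectation[OF Suc.prems(1,4)] by (simp add: has_bochner_integral_iff)
  finally show ?case .
qed simp

end

section \<open>Independence of returns\<close>

locale market = prob_space M
  for M :: "'a measure" and F :: "nat \<Rightarrow> 'a measure" and S :: "nat \<Rightarrow> 'a \<Rightarrow> real"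
    and \<kappa> :: "nat \<Rightarrow> real \<Rightarrow> real measure" and N :: nat +
  assumes filtration: "filtration_upto M F N"
    and martingale: "martingale_upto M F S N"
    and price_pos: "t \<le> N \<Longrightarrow> \<omega> \<in> space M \<Longrightarrow> 0 < S t \<omega>"
    and A1: "assumption_A1 M F S \<kappa> N"
    and A2: "assumption_A2 \<kappa> N"
begin

lemma subalgebra_F: "t \<le> N \<Longrightarrow> subalgebra M (F t)"
  using filtration by (simp add: filtration_upto_def)

lemma sigma_finite_F: "t \<le> N \<Longrightarrow> sigma_finite_subalgebra M (F t)"
  by (intro finite_measure_subalgebra_is_sigma_finite finite_measure_subalgebra.intro
      finite_measure_subalgebra_axioms.intro subalgebra_F) unfold_locales

lemma space_F: "t \<le> N \<Longrightarrow> space (F t) = space M"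
  using subalgebra_F by (simp add: subalgebra_def)

lemma F_mono: "t < N \<Longrightarrow> subalgebra (F (Suc t)) (F t)"
  using filtration by (simp add: filtration_upto_def)

lemma price_measurable: "t \<le> N \<Longrightarrow> S t \<in> borel_measurable (F t)"
  using martingale by (simp add: martingale_upto_def adapted_upto_def)

lemma price_measurable_M: "t \<le> N \<Longrightarrow> S t \<in> borel_measurable M"
  by (rule measurable_from_subalg[OF subalgebra_F price_measurable])

lemma price_integrable: "t \<le> N \<Longrightarrow> integrable M (S t)"
  using martingale by (simp add: martingale_upto_def)

lemma kernel_measurable: "t < N \<Longrightarrow> \<kappa> t \<in> restrict_space borel {0<..} \<rightarrow>\<^sub>M prob_algebra borel"
  using A1 by (simp add: assumption_A1_def markov_upto_def transition_kernels_def)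

lemma kernel_pos: "t < N \<Longrightarrow> 0 < s \<Longrightarrow> AE y in \<kappa> t s. 0 < y"
  using A1 by (simp add: assumption_A1_def markov_upto_def transition_kernels_def)

lemma kernel_distribution: "real_distribution (\<kappa> t s)" if "t < N" "0 < s"
proof -
  have "\<kappa> t s \<in> space (prob_algebra borel)"
    using measurable_space[OF kernel_measurable[OF that(1)], of s] that
    by (simp add: space_restrict_space)
  then show ?thesis
    by (auto simp: space_prob_algebra real_distribution_def real_distribution_axioms_def)
qed

lemma kernel_scaling: "\<kappa> t s = distr (\<kappa> t 1) borel (\<lambda>y. s * y)" if t: "t < N" and s: "0 < s"
proof (rule real_distribution_eqI_put)
  interpret R: real_distribution "\<kappa> t 1" by (rule kernel_distribution[OF t]) simp
  show "real_distribution (\<kappa> t s)" by (rule kernel_distribution[OF t s])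
  show "real_distribution (distr (\<kappa> t 1) borel (\<lambda>y. s * y))"
    by (auto simp: real_distribution_def real_distribution_axioms_def intro: R.prob_space_distr)
  show "AE y in \<kappa> t s. 0 < y" by (rule kernel_pos[OF t s])
  show "AE y in distr (\<kappa> t 1) borel (\<lambda>y. s * y). 0 < y"
    using kernel_pos[OF t, of 1] s by (subst AE_distr_iff) auto
  fix K :: real assume K: "0 < K"
  have "(\<integral>y. max 0 (K - y) \<partial>\<kappa> t s) = put \<kappa> t (s * (K / s)) (s * 1)"
    using s by (simp add: put_def)
  also have "\<dots> = s * put \<kappa> t (K / s) 1"
    using A2 t s K by (intro A2[unfolded assumption_A2_def, rule_format]) auto
  also have "\<dots> = (\<integral>y. s * max 0 (K / s - y) \<partial>\<kappa> t 1)"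
    by (simp add: put_def)
  also have "\<dots> = (\<integral>y. max 0 (K - s * y) \<partial>\<kappa> t 1)"
    using s by (intro Bochner_Integration.integral_cong) (auto simp: max_mult_distrib_left algebra_simps)
  finally show "(\<integral>y. max 0 (K - y) \<partial>\<kappa> t s) = (\<integral>y. max 0 (K - y) \<partial>distr (\<kappa> t 1) borel (\<lambda>y. s * y))"
    by (subst integral_distr) auto
qed

text \<open>The Markov property holds for each B off a null set depending on B. Integrating over A
  removes these null sets and leaves the joint law on rectangles, an intersection-stable
  generator.\<close>

lemma markov_rectangle:
  assumes t: "t < N" and A: "A \<in> sets (F t)" and B: "B \<in> sets borel"
  shows "emeasure M (A \<inter> S (Suc t) -` B) =
    (\<integral>\<^sup>+\<omega>. indicator A \<omega> * emeasure (\<kappa> t (S t \<omega>)) B \<partial>M)"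
proof -
  have sub: "subalgebra M (F t)" using subalgebra_F t by simp
  have sf: "sigma_finite_subalgebra M (F t)"
    using t by (intro sigma_finite_F) simp
  interpret sigma_finite_subalgebra M "F t" by (rule sf)
  have A': "A \<in> sets M" using A sub by (auto simp: subalgebra_def)
  note [measurable] = A' B
  have [measurable]: "S (Suc t) \<in> borel_measurable M" using t by (intro price_measurable_M) simp
  let ?f = "\<lambda>\<omega>. indicator B (S (Suc t) \<omega>) :: real"
  have int: "integrable M ?f"
    by (rule integrable_const_bound[where B = 1]) (auto split: split_indicator)
  have AE: "AE \<omega> in M. real_cond_exp M (F t) ?f \<omega> = measure (\<kappa> t (S t \<omega>)) B"
    using A1 t B by (auto simp: assumption_A1_def markov_upto_def)
  have nonneg: "AE \<omega> in M. 0 \<le> indicator A \<omega> * real_cond_exp M (F t) ?f \<omega>"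
    using AE by eventually_elim (auto split: split_indicator)
  have intA: "integrable M (\<lambda>\<omega>. indicator A \<omega> * real_cond_exp M (F t) ?f \<omega>)"
    using integrable_mult_indicator[OF A' real_cond_exp_int(1)[OF int]] by simp
  have "emeasure M (A \<inter> S (Suc t) -` B) = (\<integral>\<^sup>+\<omega>. indicator (A \<inter> S (Suc t) -` B \<inter> space M) \<omega> \<partial>M)"
    using sets.sets_into_space[OF A'] by (subst nn_integral_indicator) (auto intro!: arg_cong[where f = "emeasure M"])
  also have "\<dots> = (\<integral>\<^sup>+\<omega>. ennreal (indicator A \<omega> * ?f \<omega>) \<partial>M)"
    by (intro nn_integral_cong) (auto split: split_indicator)
  also have "\<dots> = ennreal (\<integral>\<omega>. indicator A \<omega> * ?f \<omega> \<partial>M)"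
    using integrable_mult_indicator[OF A' int] by (intro nn_integral_eq_integral) auto
  also have "(\<integral>\<omega>. indicator A \<omega> * ?f \<omega> \<partial>M) = (\<integral>\<omega>. indicator A \<omega> * real_cond_exp M (F t) ?f \<omega> \<partial>M)"
    using real_cond_exp_intA[OF int A] by (simp add: set_lebesgue_integral_def)
  also have "ennreal \<dots> = (\<integral>\<^sup>+\<omega>. ennreal (indicator A \<omega> * real_cond_exp M (F t) ?f \<omega>) \<partial>M)"
    using intA nonneg by (rule nn_integral_eq_integral[symmetric])
  also have "\<dots> = (\<integral>\<^sup>+\<omega>. indicator A \<omega> * emeasure (\<kappa> t (S t \<omega>)) B \<partial>M)"
  proof (rule nn_integral_cong_AE)
    show "AE \<omega> in M. ennreal (indicator A \<omega> * real_cond_exp M (F t) ?f \<omega>)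
        = indicator A \<omega> * emeasure (\<kappa> t (S t \<omega>)) B"
      using AE AE_space
    proof eventually_elim
      case (elim \<omega>)
      interpret R: real_distribution "\<kappa> t (S t \<omega>)"
        using t elim(2) by (intro kernel_distribution price_pos) auto
      show ?case
        using elim(1) by (auto split: split_indicator simp: R.emeasure_eq_measure)
    qed
  qed
  finally show ?thesis .
qed

section \<open>Independence of the next return from the past\<close>

definition gross_return :: "nat \<Rightarrow> 'a \<Rightarrow> real" where
  "gross_return t \<omega> = S (Suc t) \<omega> / S t \<omega>"

lemma gross_return_measurable: "t < N \<Longrightarrow> gross_return t \<in> borel_measurable M"
  unfolding gross_return_def by (intro borel_measurable_divide price_measurable_M) auto

lemma gross_return_pos: "t < N \<Longrightarrow> \<omega> \<in> space M \<Longrightarrow> 0 < gross_return t \<omega>"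
  by (simp add: gross_return_def price_pos)

text \<open>Independence is stated for the pair of the whole outcome, seen through F t, and the
  return. Integrands may then depend on the outcome through any F t-measurable quantities, such as
  the fund and the withdrawal level.\<close>

lemma gross_return_joint_distribution:
  assumes t: "t < N"
  shows "distr M (F t \<Otimes>\<^sub>M borel) (\<lambda>\<omega>. (\<omega>, gross_return t \<omega>)) = restr_to_subalg M (F t) \<Otimes>\<^sub>M \<kappa> t 1"
proof -
  let ?F = "restr_to_subalg M (F t)" and ?\<nu> = "\<kappa> t 1" and ?P = "F t \<Otimes>\<^sub>M (borel :: real measure)"
  have sub: "subalgebra M (F t)" using subalgebra_F t by simp
  interpret R: real_distribution ?\<nu> by (rule kernel_distribution[OF t]) simp
  have space: "space (F t) = space M" using space_F t by simp
  have setsF [measurable_cong]: "sets ?F = sets (F t)" by (rule sets_restr_to_subalg[OF sub])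
  have spaceF: "space ?F = space M" by (simp add: space_restr_to_subalg)
  have St [measurable]: "S t \<in> borel_measurable (F t)" using price_measurable t by simp
  have [measurable]: "S (Suc t) \<in> borel_measurable M" "S t \<in> borel_measurable M"
    using t by (auto intro: price_measurable_M)
  have id [measurable]: "(\<lambda>\<omega>. \<omega>) \<in> M \<rightarrow>\<^sub>M F t"
    using sub by (rule measurable_from_subalg) simp
  \<comment> \<open>The Markov property concerns the next price, so the joint law with
    \<open>S (Suc t)\<close> is identified first; \<open>m2\<close> is its candidate, built from an
    independent return scaled by the current price.\<close>
  define m1 where "m1 = distr M ?P (\<lambda>\<omega>. (\<omega>, S (Suc t) \<omega>))"
  define m2 where "m2 = distr (?F \<Otimes>\<^sub>M ?\<nu>) ?P (\<lambda>(\<omega>, \<rho>). (\<omega>, S t \<omega> * \<rho>))"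
  let ?E = "{a \<times> b | a b. a \<in> sets (F t) \<and> b \<in> sets (borel :: real measure)}"
  have "m1 = m2"
  proof (rule measure_eqI_generator_eq[OF Int_stable_pair_measure_generator[of "F t" borel], where \<Omega> = "space ?P"])
    show "?E \<subseteq> Pow (space ?P)"
      using sets.space_closed[of "F t"] by (auto simp: space_pair_measure)
    show "sets m1 = sigma_sets (space ?P) ?E" "sets m2 = sigma_sets (space ?P) ?E"
      by (simp_all add: m1_def m2_def sets_pair_measure space_pair_measure)
    show "range (\<lambda>_ :: nat. space ?P) \<subseteq> ?E"
      unfolding space_pair_measure using sets.top[of "F t"] sets.top[of borel] by blast
    show "(\<Union>i :: nat. space ?P) = space ?P" by simp
    interpret m1: prob_space m1
      unfolding m1_def by (rule prob_space_distr) measurable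
    show "emeasure m1 (space ?P) \<noteq> \<infinity>" by simp
    fix C assume "C \<in> ?E"
    then obtain A B where C: "C = A \<times> B" and A: "A \<in> sets (F t)" and B: "B \<in> sets (borel :: real measure)"
      by auto
    have AM: "A \<subseteq> space M" using sets.sets_into_space[OF A] space by simp
    have "emeasure m1 C = emeasure M (A \<inter> S (Suc t) -` B)"
      unfolding m1_def C using A B AM
      by (subst emeasure_distr) (auto intro!: arg_cong[where f = "emeasure M"])
    also have "\<dots> = (\<integral>\<^sup>+\<omega>. indicator A \<omega> * emeasure (\<kappa> t (S t \<omega>)) B \<partial>M)"
      by (rule markov_rectangle[OF t A B])
    also have "\<dots> = (\<integral>\<^sup>+\<omega>. indicator A \<omega> * emeasure ?\<nu> {\<rho>. S t \<omega> * \<rho> \<in> B} \<partial>M)"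
    proof (rule nn_integral_cong)
      fix \<omega> assume "\<omega> \<in> space M"
      then have "0 < S t \<omega>" using t price_pos by simp
      then have "emeasure (\<kappa> t (S t \<omega>)) B = emeasure ?\<nu> {\<rho>. S t \<omega> * \<rho> \<in> B}"
        unfolding kernel_scaling[OF t \<open>0 < S t \<omega>\<close>] using B
        by (subst emeasure_distr) (auto intro!: arg_cong[where f = "emeasure ?\<nu>"])
      then show "indicator A \<omega> * emeasure (\<kappa> t (S t \<omega>)) B = indicator A \<omega> * emeasure ?\<nu> {\<rho>. S t \<omega> * \<rho> \<in> B}"
        by simp
    qed
    also have "\<dots> = (\<integral>\<^sup>+\<omega>. (\<integral>\<^sup>+\<rho>. indicator C (\<omega>, S t \<omega> * \<rho>) \<partial>?\<nu>) \<partial>M)"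
    proof (rule nn_integral_cong)
      fix \<omega>
      have "{\<rho>. S t \<omega> * \<rho> \<in> B} \<in> sets ?\<nu>"
        using measurable_sets[of "\<lambda>\<rho>. S t \<omega> * \<rho>" borel borel B] B by (simp add: vimage_def)
      then have "indicator A \<omega> * emeasure ?\<nu> {\<rho>. S t \<omega> * \<rho> \<in> B}
          = (\<integral>\<^sup>+\<rho>. indicator A \<omega> * indicator {\<rho>. S t \<omega> * \<rho> \<in> B} \<rho> \<partial>?\<nu>)"
        by (simp add: nn_integral_cmult)
      also have "\<dots> = (\<integral>\<^sup>+\<rho>. indicator C (\<omega>, S t \<omega> * \<rho>) \<partial>?\<nu>)"
        by (intro nn_integral_cong) (auto simp: C split: split_indicator)
      finally show "indicator A \<omega> * emeasure ?\<nu> {\<rho>. S t \<omega> * \<rho> \<in> B}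
          = (\<integral>\<^sup>+\<rho>. indicator C (\<omega>, S t \<omega> * \<rho>) \<partial>?\<nu>)" .
    qed
    also have "\<dots> = (\<integral>\<^sup>+\<omega>. (\<integral>\<^sup>+\<rho>. indicator C (\<omega>, S t \<omega> * \<rho>) \<partial>?\<nu>) \<partial>?F)"
    proof (rule nn_integral_subalgebra2[OF sub, symmetric])
      have [measurable]: "C \<in> sets ?P" using A B by (simp add: C)
      show "(\<lambda>\<omega>. \<integral>\<^sup>+\<rho>. indicator C (\<omega>, S t \<omega> * \<rho>) \<partial>?\<nu>) \<in> borel_measurable (F t)"
        by measurable
    qed
    also have "\<dots> = (\<integral>\<^sup>+x. indicator C (fst x, S t (fst x) * snd x) \<partial>(?F \<Otimes>\<^sub>M ?\<nu>))"
    proof -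
      have [measurable]: "C \<in> sets ?P" using A B by (simp add: C)
      show ?thesis
        by (subst R.nn_integral_fst[symmetric]) auto
    qed
    also have "\<dots> = (\<integral>\<^sup>+x. indicator C x \<partial>m2)"
    proof -
      have [measurable]: "C \<in> sets ?P" using A B by (simp add: C)
      show ?thesis
        unfolding m2_def by (subst nn_integral_distr) (auto simp: case_prod_beta)
    qed
    also have "\<dots> = emeasure m2 C"
      using A B by (subst nn_integral_indicator) (auto simp: m2_def C)
    finally show "emeasure m1 C = emeasure m2 C" .
  qed
  \<comment> \<open>Dividing the second coordinate by the current price undoes the scaling and turns
    prices into returns on both sides.\<close>
  then have "distr m1 ?P (\<lambda>(\<omega>, y). (\<omega>, y / S t \<omega>)) = distr m2 ?P (\<lambda>(\<omega>, y). (\<omega>, y / S t \<omega>))"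
    by simp
  moreover have "distr m1 ?P (\<lambda>(\<omega>, y). (\<omega>, y / S t \<omega>)) = distr M ?P (\<lambda>\<omega>. (\<omega>, gross_return t \<omega>))"
    unfolding m1_def by (subst distr_distr) (auto simp: comp_def gross_return_def)
  moreover have "distr m2 ?P (\<lambda>(\<omega>, y). (\<omega>, y / S t \<omega>)) = ?F \<Otimes>\<^sub>M ?\<nu>"
  proof -
    have "distr m2 ?P (\<lambda>(\<omega>, y). (\<omega>, y / S t \<omega>))
        = distr (?F \<Otimes>\<^sub>M ?\<nu>) ?P ((\<lambda>(\<omega>, y). (\<omega>, y / S t \<omega>)) \<circ> (\<lambda>(\<omega>, \<rho>). (\<omega>, S t \<omega> * \<rho>)))"
      unfolding m2_def by (subst distr_distr) auto
    also have "\<dots> = distr (?F \<Otimes>\<^sub>M ?\<nu>) (?F \<Otimes>\<^sub>M ?\<nu>) (\<lambda>x. x)"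
    proof (rule distr_cong[OF refl])
      show "sets ?P = sets (?F \<Otimes>\<^sub>M ?\<nu>)"
        by (rule sets_pair_measure_cong) (simp_all add: setsF)
      fix x assume "x \<in> space (?F \<Otimes>\<^sub>M ?\<nu>)"
      then have "0 < S t (fst x)" using t by (auto simp: space_pair_measure spaceF intro: price_pos)
      then show "((\<lambda>(\<omega>, y). (\<omega>, y / S t \<omega>)) \<circ> (\<lambda>(\<omega>, \<rho>). (\<omega>, S t \<omega> * \<rho>))) x = x"
        by (cases x) simp
    qed
    also have "\<dots> = ?F \<Otimes>\<^sub>M ?\<nu>" by (rule distr_id)
    finally show ?thesis .
  qed
  ultimately show ?thesis by simp
qed

text \<open>The nonnegative version serves where integrability is still to be established: for the
  mean return and for the product of fund and return.\<close>

lemma gross_return_nn_integral: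
  assumes t: "t < N" and h: "h \<in> borel_measurable (F t \<Otimes>\<^sub>M borel)"
  shows "(\<integral>\<^sup>+\<omega>. h (\<omega>, gross_return t \<omega>) \<partial>M) = (\<integral>\<^sup>+\<omega>. (\<integral>\<^sup>+\<rho>. h (\<omega>, \<rho>) \<partial>\<kappa> t 1) \<partial>M)"
proof -
  let ?F = "restr_to_subalg M (F t)" and ?P = "F t \<Otimes>\<^sub>M (borel :: real measure)"
  have sub: "subalgebra M (F t)" using subalgebra_F t by simp
  interpret R: real_distribution "\<kappa> t 1" by (rule kernel_distribution[OF t]) simp
  have setsF [measurable_cong]: "sets ?F = sets (F t)" by (rule sets_restr_to_subalg[OF sub])
  have [measurable]: "(\<lambda>\<omega>. \<omega>) \<in> M \<rightarrow>\<^sub>M F t"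
    using sub by (rule measurable_from_subalg) simp
  note gross_return_measurable[OF t, measurable] h [measurable]
  have "(\<integral>\<^sup>+\<omega>. h (\<omega>, gross_return t \<omega>) \<partial>M) = (\<integral>\<^sup>+x. h x \<partial>distr M ?P (\<lambda>\<omega>. (\<omega>, gross_return t \<omega>)))"
    by (subst nn_integral_distr) auto
  also have "\<dots> = (\<integral>\<^sup>+\<omega>. (\<integral>\<^sup>+\<rho>. h (\<omega>, \<rho>) \<partial>\<kappa> t 1) \<partial>?F)"
    unfolding gross_return_joint_distribution[OF t] by (subst R.nn_integral_fst[symmetric]) auto
  also have "\<dots> = (\<integral>\<^sup>+\<omega>. (\<integral>\<^sup>+\<rho>. h (\<omega>, \<rho>) \<partial>\<kappa> t 1) \<partial>M)"
    by (rule nn_integral_subalgebra2[OF sub]) measurable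
  finally show ?thesis .
qed

lemma gross_return_integral:
  fixes h :: "'a \<times> real \<Rightarrow> real"
  assumes t: "t < N" and h [measurable]: "h \<in> borel_measurable (F t \<Otimes>\<^sub>M borel)"
    and int: "integrable M (\<lambda>\<omega>. h (\<omega>, gross_return t \<omega>))"
  shows "integrable M (\<lambda>\<omega>. \<integral>\<rho>. h (\<omega>, \<rho>) \<partial>\<kappa> t 1)"
    and "(\<integral>\<omega>. h (\<omega>, gross_return t \<omega>) \<partial>M) = (\<integral>\<omega>. (\<integral>\<rho>. h (\<omega>, \<rho>) \<partial>\<kappa> t 1) \<partial>M)"
proof -
  let ?F = "restr_to_subalg M (F t)" and ?P = "F t \<Otimes>\<^sub>M (borel :: real measure)"
  have sub: "subalgebra M (F t)" using subalgebra_F t by simp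
  interpret R: real_distribution "\<kappa> t 1" by (rule kernel_distribution[OF t]) simp
  interpret F: prob_space ?F by (rule prob_space_restr_to_subalg[OF sub]) unfold_locales
  interpret pair_sigma_finite ?F "\<kappa> t 1" ..
  have setsF [measurable_cong]: "sets ?F = sets (F t)" by (rule sets_restr_to_subalg[OF sub])
  have [measurable]: "(\<lambda>\<omega>. \<omega>) \<in> M \<rightarrow>\<^sub>M F t"
    using sub by (rule measurable_from_subalg) simp
  note gross_return_measurable[OF t, measurable]
  have prod: "integrable (?F \<Otimes>\<^sub>M \<kappa> t 1) h"
    using int unfolding gross_return_joint_distribution[OF t, symmetric]
    by (subst integrable_distr_eq) auto
  then have prod': "integrable (?F \<Otimes>\<^sub>M \<kappa> t 1) (case_prod (\<lambda>\<omega> \<rho>. h (\<omega>, \<rho>)))" by simp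
  show "integrable M (\<lambda>\<omega>. \<integral>\<rho>. h (\<omega>, \<rho>) \<partial>\<kappa> t 1)"
    by (rule integrable_from_subalg[OF sub integrable_fst[OF prod']])
  have "(\<integral>\<omega>. h (\<omega>, gross_return t \<omega>) \<partial>M) = (\<integral>x. h x \<partial>(?F \<Otimes>\<^sub>M \<kappa> t 1))"
    unfolding gross_return_joint_distribution[OF t, symmetric] by (subst integral_distr) auto
  also have "\<dots> = (\<integral>\<omega>. (\<integral>\<rho>. h (\<omega>, \<rho>) \<partial>\<kappa> t 1) \<partial>?F)"
    using integral_fst[OF prod'] by simp
  also have "\<dots> = (\<integral>\<omega>. (\<integral>\<rho>. h (\<omega>, \<rho>) \<partial>\<kappa> t 1) \<partial>M)"
    by (rule integral_subalgebra2[OF sub]) measurable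
  finally show "(\<integral>\<omega>. h (\<omega>, gross_return t \<omega>) \<partial>M) = (\<integral>\<omega>. (\<integral>\<rho>. h (\<omega>, \<rho>) \<partial>\<kappa> t 1) \<partial>M)" .
qed

text \<open>The martingale property gives equal means to consecutive prices, and independence
  factors the later mean into the earlier one times the mean return. Extended nonnegative integrals
  make integrability of the return part of the result.\<close>

lemma gross_return_mean:
  assumes t: "t < N"
  shows "(\<integral>\<^sup>+\<rho>. ennreal \<rho> \<partial>\<kappa> t 1) = 1"
proof -
  have sub: "subalgebra M (F t)" using subalgebra_F t by simp
  have sf: "sigma_finite_subalgebra M (F t)"
    using t by (intro sigma_finite_F) simp
  interpret sigma_finite_subalgebra M "F t" by (rule sf)
  interpret R: real_distribution "\<kappa> t 1" by (rule kernel_distribution[OF t]) simp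
  have St [measurable]: "S t \<in> borel_measurable (F t)" using price_measurable t by simp
  have [measurable]: "S t \<in> borel_measurable M" using price_measurable_M t by simp
  have AE: "AE \<omega> in M. real_cond_exp M (F t) (S (Suc t)) \<omega> = S t \<omega>"
    using martingale t by (simp add: martingale_upto_def)
  have int: "integrable M (S t)" "integrable M (S (Suc t))"
    using t by (auto intro: price_integrable)
  have pos: "AE \<omega> in M. 0 \<le> S u \<omega>" if "u \<le> N" for u
    by (rule AE_I2) (use price_pos that in \<open>auto intro: less_imp_le\<close>)
  have "(\<integral>\<omega>. S (Suc t) \<omega> \<partial>M) = (\<integral>\<omega>. real_cond_exp M (F t) (S (Suc t)) \<omega> \<partial>M)"
    using real_cond_exp_int(2)[OF int(2)] by simp
  also have "\<dots> = (\<integral>\<omega>. S t \<omega> \<partial>M)"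
    by (rule integral_cong_AE) (use AE in auto)
  finally have "(\<integral>\<^sup>+\<omega>. ennreal (S (Suc t) \<omega>) \<partial>M) = (\<integral>\<^sup>+\<omega>. ennreal (S t \<omega>) \<partial>M)"
    using t int pos by (simp add: nn_integral_eq_integral)
  moreover have "(\<integral>\<^sup>+\<omega>. ennreal (S (Suc t) \<omega>) \<partial>M) = (\<integral>\<^sup>+\<omega>. ennreal (S t \<omega> * gross_return t \<omega>) \<partial>M)"
  proof (rule nn_integral_cong)
    fix \<omega> assume "\<omega> \<in> space M"
    then have "0 < S t \<omega>" using t by (intro price_pos) auto
    then show "ennreal (S (Suc t) \<omega>) = ennreal (S t \<omega> * gross_return t \<omega>)"
      by (simp add: gross_return_def)
  qed
  moreover have "(\<integral>\<^sup>+\<omega>. ennreal (S t \<omega> * gross_return t \<omega>) \<partial>M)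
      = (\<integral>\<^sup>+\<omega>. (\<integral>\<^sup>+\<rho>. ennreal (S t \<omega> * \<rho>) \<partial>\<kappa> t 1) \<partial>M)"
    using gross_return_nn_integral[OF t, of "\<lambda>(\<omega>, \<rho>). ennreal (S t \<omega> * \<rho>)"] by simp
  moreover have "\<dots> = (\<integral>\<^sup>+\<omega>. ennreal (S t \<omega>) * (\<integral>\<^sup>+\<rho>. ennreal \<rho> \<partial>\<kappa> t 1) \<partial>M)"
  proof (rule nn_integral_cong)
    fix \<omega> assume "\<omega> \<in> space M"
    then have "0 < S t \<omega>" using t by (intro price_pos) auto
    then have "0 \<le> S t \<omega>" by simp
    then show "(\<integral>\<^sup>+\<rho>. ennreal (S t \<omega> * \<rho>) \<partial>\<kappa> t 1) = ennreal (S t \<omega>) * (\<integral>\<^sup>+\<rho>. ennreal \<rho> \<partial>\<kappa> t 1)"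
      by (simp add: ennreal_mult' nn_integral_cmult)
  qed
  moreover have "\<dots> = (\<integral>\<^sup>+\<omega>. ennreal (S t \<omega>) \<partial>M) * (\<integral>\<^sup>+\<rho>. ennreal \<rho> \<partial>\<kappa> t 1)"
    by (rule nn_integral_multc) measurable
  \<comment> \<open>The mean price is cancelled below, which needs it to be finite and nonzero: the
    former is integrability, the latter positivity of the price.\<close>
  ultimately have eq: "(\<integral>\<^sup>+\<omega>. ennreal (S t \<omega>) \<partial>M) * (\<integral>\<^sup>+\<rho>. ennreal \<rho> \<partial>\<kappa> t 1)
      = (\<integral>\<^sup>+\<omega>. ennreal (S t \<omega>) \<partial>M) * 1"
    by simp
  have "(\<integral>\<^sup>+\<omega>. ennreal (S t \<omega>) \<partial>M) \<noteq> \<top>"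
    using t int pos by (simp add: nn_integral_eq_integral)
  moreover have "(\<integral>\<^sup>+\<omega>. ennreal (S t \<omega>) \<partial>M) \<noteq> 0"
  proof
    assume "(\<integral>\<^sup>+\<omega>. ennreal (S t \<omega>) \<partial>M) = 0"
    then have "AE \<omega> in M. ennreal (S t \<omega>) = 0"
      by (subst (asm) nn_integral_0_iff_AE) auto
    then have "AE \<omega> in M. False"
      using AE_space
    proof eventually_elim
      case (elim \<omega>)
      then show ?case using t price_pos[of t \<omega>] by (simp add: ennreal_eq_0_iff)
    qed
    then show False by simp
  qed
  ultimately show ?thesis
    using eq unfolding ennreal_mult_cancel_left by simp
qed

lemma scaling_period: "scaling_period \<kappa> t" if t: "t < N"
proof -
  interpret R: real_distribution "\<kappa> t 1" by (rule kernel_distribution[OF t]) simp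
  have pos: "AE y in \<kappa> t 1. 0 < y" by (rule kernel_pos[OF t]) simp
  then have nonneg: "AE y in \<kappa> t 1. 0 \<le> y" by eventually_elim simp
  have "has_bochner_integral (\<kappa> t 1) (\<lambda>y. y) 1"
    by (rule has_bochner_integral_nn_integral) (use gross_return_mean[OF t] nonneg in auto)
  then have "integrable (\<kappa> t 1) (\<lambda>y. y)" "(\<integral>y. y \<partial>\<kappa> t 1) = 1"
    by (simp_all add: has_bochner_integral_iff)
  moreover have "twice_differentiable_pos (\<lambda>K. put \<kappa> t K 1)"
    using A1 t by (simp add: assumption_A1_def)
  ultimately show ?thesis
    using pos kernel_scaling[OF t] by unfold_locales
qed

end

section \<open>The guarantee claims\<close>

locale guarantee = market M F S \<kappa> N
  for M :: "'a measure" and F :: "nat \<Rightarrow> 'a measure" and S :: "nat \<Rightarrow> 'a \<Rightarrow> real"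
    and \<kappa> :: "nat \<Rightarrow> real \<Rightarrow> real measure" and N :: nat +
  fixes r x\<^sub>0 w\<^sub>0 :: real
  assumes rate_gt: "- 1 < r" and initial_withdrawal_pos: "0 < w\<^sub>0"
begin

sublocale hedge: rollup \<kappa> N r
  by (intro rollup.intro scaling_period rate_gt)

abbreviation "A \<equiv> guarantee_base N r"
abbreviation "X \<equiv> fund N r x\<^sub>0 w\<^sub>0 S"
abbreviation "W \<equiv> withdrawal N r x\<^sub>0 w\<^sub>0 S"
abbreviation "\<tau> \<equiv> depletion_time N r x\<^sub>0 w\<^sub>0 S"
abbreviation "Z \<equiv> claim N r x\<^sub>0 w\<^sub>0 S"

definition later_claims :: "nat \<Rightarrow> 'a \<Rightarrow> real" where
  "later_claims t \<omega> = (\<Sum>u = t + 1..N. Z u \<omega>)"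

text \<open>The event that depletion comes after t, spelled out over the dates so that its
  membership in F t follows by induction.\<close>

definition alive :: "nat \<Rightarrow> 'a set" where
  "alive t = {\<omega> \<in> space M. \<forall>j\<le>t. 0 < X j \<omega>}"

lemma fund_Suc: "X (Suc t) \<omega> = X t \<omega> * gross_return t \<omega> - W t \<omega>"
  by (simp add: gross_return_def)

lemma withdrawal_pos: "0 < W t \<omega>"
proof (induction t)
  case (Suc t)
  then show ?case by (simp add: less_max_iff_disj)
qed (simp add: initial_withdrawal_pos)

lemma less_depletion_iff: "enat t < \<tau> \<omega> \<longleftrightarrow> (\<forall>j\<le>t. 0 < X j \<omega>)" if "t \<le> N"
proof -
  let ?D = "{enat j | j. j \<le> N \<and> X j \<omega> \<le> 0}"
  have "enat t < Inf ?D \<longleftrightarrow> (\<forall>d\<in>?D. enat t < d)"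
  proof
    assume "enat t < Inf ?D"
    then show "\<forall>d\<in>?D. enat t < d"
      by (meson Inf_lower less_le_trans)
  next
    assume *: "\<forall>d\<in>?D. enat t < d"
    show "enat t < Inf ?D"
    \<comment> \<open>Without depletion the infimum of the empty set is infinity; otherwise it is
      attained, since \<open>enat\<close> is well-ordered.\<close>
    proof (cases "?D = {}")
      case True
      then show ?thesis by (simp only: Inf_enat_def) simp
    next
      case False
      then have "Inf ?D \<in> ?D" by (metis (no_types, lifting) all_not_in_conv wellorder_InfI)
      with * show ?thesis by blast
    qed
  qed
  also have "\<dots> \<longleftrightarrow> (\<forall>j\<le>N. X j \<omega> \<le> 0 \<longrightarrow> t < j)"
    by auto
  also have "\<dots> \<longleftrightarrow> (\<forall>j\<le>t. 0 < X j \<omega>)"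
    using that by (meson le_trans not_le)
  finally show ?thesis
    by (simp add: depletion_time_def)
qed

lemma alive_iff: "\<omega> \<in> alive t \<longleftrightarrow> \<omega> \<in> space M \<and> enat t < \<tau> \<omega>" if "t \<le> N"
  using less_depletion_iff[OF that] by (simp add: alive_def)

lemma alive_Suc: "\<omega> \<in> alive (Suc t) \<longleftrightarrow> \<omega> \<in> alive t \<and> 0 < X (Suc t) \<omega>"
  by (auto simp: alive_def le_Suc_eq simp del: fund.simps)

section \<open>Measurability and integrability of fund and withdrawal level\<close>

lemma fund_withdrawal_measurable:
  "t \<le> N \<Longrightarrow> X t \<in> borel_measurable (F t) \<and> W t \<in> borel_measurable (F t)"
proof (induction t)
  case 0
  have "X 0 = (\<lambda>_. x\<^sub>0)" "W 0 = (\<lambda>_. w\<^sub>0)" by (auto simp: fun_eq_iff)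
  then show ?case by (simp del: fund.simps withdrawal.simps)
next
  case (Suc t)
  then have t: "t < N" by simp
  then have IH: "X t \<in> borel_measurable (F t)" "W t \<in> borel_measurable (F t)"
    using Suc.IH by auto
  have [measurable]: "X t \<in> borel_measurable (F (Suc t))" "W t \<in> borel_measurable (F (Suc t))"
      "S t \<in> borel_measurable (F (Suc t))"
    using t by (auto intro!: measurable_from_subalg[OF F_mono[OF t]] IH price_measurable)
  have [measurable]: "S (Suc t) \<in> borel_measurable (F (Suc t))"
    using t by (intro price_measurable) simp
  have "X (Suc t) = (\<lambda>\<omega>. X t \<omega> * (S (Suc t) \<omega> / S t \<omega>) - W t \<omega>)"
    by (auto simp: fun_eq_iff)
  then have X: "X (Suc t) \<in> borel_measurable (F (Suc t))"
    by (simp only:) measurable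
  have "W (Suc t) = (\<lambda>\<omega>. max (W t \<omega>) (X (Suc t) \<omega> / A (Suc t)))"
    by (auto simp: fun_eq_iff)
  moreover note X [measurable]
  have "(\<lambda>\<omega>. max (W t \<omega>) (X (Suc t) \<omega> / A (Suc t))) \<in> borel_measurable (F (Suc t))"
    by measurable
  ultimately have "W (Suc t) \<in> borel_measurable (F (Suc t))" by (simp only:)
  with X show ?case ..
qed

lemma fund_measurable: "t \<le> N \<Longrightarrow> X t \<in> borel_measurable (F t)"
  and withdrawal_measurable: "t \<le> N \<Longrightarrow> W t \<in> borel_measurable (F t)"
  using fund_withdrawal_measurable by auto

lemma fund_measurable_M: "t \<le> N \<Longrightarrow> X t \<in> borel_measurable M"
  by (blast intro: measurable_from_subalg subalgebra_F fund_measurable)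

lemma F_le: "s \<le> t \<Longrightarrow> t \<le> N \<Longrightarrow> sets (F s) \<subseteq> sets (F t)"
proof (induction t rule: dec_induct)
  case (step t)
  then show ?case using F_mono[of t] by (auto simp: subalgebra_def)
qed simp

lemma alive_sets: "alive t \<in> sets (F t)" if "t \<le> N"
  using that
proof (induction t)
  case 0
  have [measurable]: "X 0 \<in> borel_measurable (F 0)" by (intro fund_measurable) simp
  have "alive 0 = {\<omega> \<in> space (F 0). 0 < X 0 \<omega>}"
    using space_F[of 0] by (auto simp: alive_def)
  also have "\<dots> \<in> sets (F 0)" by measurable
  finally show ?case .
next
  case (Suc t)
  have [measurable]: "X (Suc t) \<in> borel_measurable (F (Suc t))" by (intro fund_measurable Suc.prems)
  have "alive t \<in> sets (F (Suc t))"
    using F_le[of t "Suc t"] Suc by auto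
  moreover have "alive (Suc t) = alive t \<inter> {\<omega> \<in> space (F (Suc t)). 0 < X (Suc t) \<omega>}"
    using space_F[OF Suc.prems] by (auto simp: alive_def le_Suc_eq simp del: fund.simps)
  moreover have "{\<omega> \<in> space (F (Suc t)). 0 < X (Suc t) \<omega>} \<in> sets (F (Suc t))" by measurable
  ultimately show ?case by (simp only: sets.Int)
qed

lemma alive_sets_M: "alive t \<in> sets M" if "t \<le> N"
  using alive_sets[OF that] subalgebra_F[OF that] by (auto simp: subalgebra_def)

text \<open>A product of integrable functions need not be integrable; here independence and mean
  return 1 give the product the same absolute first moment as the fund.\<close>

lemma fund_times_return_integrable:
  assumes t: "t < N" and X: "integrable M (X t)"
  shows "integrable M (\<lambda>\<omega>. X t \<omega> * gross_return t \<omega>)"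
proof (rule integrableI_bounded)
  note [measurable] = gross_return_measurable[OF t]
  have [measurable]: "X t \<in> borel_measurable M" "X t \<in> borel_measurable (F t)"
    using t by (auto intro: fund_measurable_M fund_measurable)
  show "(\<lambda>\<omega>. X t \<omega> * gross_return t \<omega>) \<in> borel_measurable M" by measurable
  interpret R: real_distribution "\<kappa> t 1" by (rule kernel_distribution[OF t]) simp
  have "(\<integral>\<^sup>+\<omega>. ennreal (norm (X t \<omega> * gross_return t \<omega>)) \<partial>M)
      = (\<integral>\<^sup>+\<omega>. ennreal \<bar>X t \<omega>\<bar> * ennreal (gross_return t \<omega>) \<partial>M)"
  proof (rule nn_integral_cong)
    fix \<omega> assume "\<omega> \<in> space M"
    then have "0 < gross_return t \<omega>" by (rule gross_return_pos[OF t])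
    then show "ennreal (norm (X t \<omega> * gross_return t \<omega>)) = ennreal \<bar>X t \<omega>\<bar> * ennreal (gross_return t \<omega>)"
      by (simp add: abs_mult ennreal_mult')
  qed
  also have "\<dots> = (\<integral>\<^sup>+\<omega>. (\<integral>\<^sup>+\<rho>. ennreal \<bar>X t \<omega>\<bar> * ennreal \<rho> \<partial>\<kappa> t 1) \<partial>M)"
    using gross_return_nn_integral[OF t, of "\<lambda>(\<omega>, \<rho>). ennreal \<bar>X t \<omega>\<bar> * ennreal \<rho>"] by simp
  also have "\<dots> = (\<integral>\<^sup>+\<omega>. ennreal \<bar>X t \<omega>\<bar> \<partial>M)"
    by (simp add: nn_integral_cmult gross_return_mean[OF t])
  also have "\<dots> < \<infinity>"
    using X by (simp add: integrable_iff_bounded)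
  finally show "(\<integral>\<^sup>+\<omega>. ennreal (norm (X t \<omega> * gross_return t \<omega>)) \<partial>M) < \<infinity>" .
qed

lemma fund_withdrawal_integrable: "t \<le> N \<Longrightarrow> integrable M (X t) \<and> integrable M (W t)"
proof (induction t)
  case 0
  have "X 0 = (\<lambda>_. x\<^sub>0)" "W 0 = (\<lambda>_. w\<^sub>0)" by (auto simp: fun_eq_iff)
  then show ?case by (simp del: fund.simps withdrawal.simps)
next
  case (Suc t)
  then have t: "t < N" by simp
  then have IH: "integrable M (X t)" "integrable M (W t)" using Suc.IH by auto
  have X: "integrable M (X (Suc t))"
    unfolding fund_Suc[abs_def] by (intro Bochner_Integration.integrable_diff fund_times_return_integrable t IH)
  have "W (Suc t) = (\<lambda>\<omega>. max (W t \<omega>) (X (Suc t) \<omega> / A (Suc t)))"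
    by (auto simp: fun_eq_iff)
  moreover have "integrable M (\<lambda>\<omega>. max (W t \<omega>) (X (Suc t) \<omega> / A (Suc t)))"
    using IH X by (intro integrable_max integrable_divide)
  ultimately have "integrable M (W (Suc t))" by (simp only:)
  with X show ?case ..
qed

lemma fund_integrable: "t \<le> N \<Longrightarrow> integrable M (X t)"
  and withdrawal_integrable: "t \<le> N \<Longrightarrow> integrable M (W t)"
  using fund_withdrawal_integrable by auto

section \<open>The claims along a path\<close>

lemma claim_eq:
  assumes "u < N" "\<omega> \<in> space M"
  shows "Z (Suc u) \<omega> = indicator (space M - alive u) \<omega> * W u \<omega>
    + indicator (alive u - alive (Suc u)) \<omega> * neg_part (X (Suc u) \<omega>)"
proof -
  have 1: "\<tau> \<omega> \<le> enat u \<longleftrightarrow> \<omega> \<notin> alive u"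
    using assms by (simp add: alive_iff not_less)
  have 2: "\<tau> \<omega> = enat (Suc u) \<longleftrightarrow> \<omega> \<in> alive u \<and> \<omega> \<notin> alive (Suc u)"
  proof -
    have "\<omega> \<in> alive u \<longleftrightarrow> enat (Suc u) \<le> \<tau> \<omega>" "\<omega> \<notin> alive (Suc u) \<longleftrightarrow> \<tau> \<omega> \<le> enat (Suc u)"
      using assms by (simp_all add: alive_iff not_less Suc_ile_eq)
    then show ?thesis by (auto intro: antisym)
  qed
  show ?thesis
    using assms(2) by (simp add: claim_def 1 2 indicator_def del: fund.simps withdrawal.simps)
qed

lemma neg_part_abs: "\<bar>neg_part x\<bar> \<le> \<bar>x\<bar>"
  by (simp add: neg_part_def min_def)

lemma claim_integrable: "integrable M (Z (Suc u))" if "u < N"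
proof -
  have a: "alive u \<in> sets M" "alive (Suc u) \<in> sets M"
    using that by (auto intro: alive_sets_M)
  have [measurable]: "X (Suc u) \<in> borel_measurable M"
    using that by (intro fund_measurable_M) simp
  have "integrable M (\<lambda>\<omega>. neg_part (X (Suc u) \<omega>))"
  proof (rule Bochner_Integration.integrable_bound)
    show "integrable M (X (Suc u))" using that by (intro fund_integrable) simp
    show "(\<lambda>\<omega>. neg_part (X (Suc u) \<omega>)) \<in> borel_measurable M"
      unfolding neg_part_def by measurable
  qed (simp add: neg_part_abs del: fund.simps)
  then have "integrable M (\<lambda>\<omega>. indicator (space M - alive u) \<omega> *\<^sub>R W u \<omega>
    + indicator (alive u - alive (Suc u)) \<omega> *\<^sub>R neg_part (X (Suc u) \<omega>))"
    using that a by (intro Bochner_Integration.integrable_add integrable_mult_indicator withdrawal_integrable) auto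
  then show ?thesis
    by (rule Bochner_Integration.integrable_cong[OF refl, THEN iffD1, rotated])
      (simp add: claim_eq[OF that] del: fund.simps)
qed

lemma later_claims_integrable: "integrable M (later_claims t)"
  unfolding later_claims_def[abs_def]
proof (rule Bochner_Integration.integrable_sum)
  fix u assume "u \<in> {t + 1..N}"
  then have "u = Suc (u - 1)" "u - 1 < N" by auto
  then show "integrable M (Z u)" using claim_integrable[of "u - 1"] by simp
qed

text \<open>Returns are positive and withdrawals continue, so a nonpositive fund stays nonpositive;
  the ratio to the guarantee base is then at most 0 and never exceeds the positive withdrawal
  level.\<close>

lemma withdrawal_frozen:
  assumes \<omega>: "\<omega> \<in> space M" and dep: "X (Suc t) \<omega> \<le> 0"
  shows "Suc t \<le> k \<Longrightarrow> k < N \<Longrightarrow> X k \<omega> \<le> 0 \<and> W k \<omega> = W t \<omega>"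
proof (induction k rule: dec_induct)
  case base
  have "X (Suc t) \<omega> / A (Suc t) \<le> 0"
    using dep hedge.base_pos[OF base] by (simp add: divide_nonpos_pos)
  then have "max (W t \<omega>) (X (Suc t) \<omega> / A (Suc t)) = W t \<omega>"
    using withdrawal_pos[of t \<omega>] by linarith
  then show ?case using dep by (simp del: fund.simps)
next
  case (step k)
  then have k: "k < N" and IH: "X k \<omega> \<le> 0" "W k \<omega> = W t \<omega>" by auto
  have "X k \<omega> * gross_return k \<omega> \<le> 0"
    using IH(1) gross_return_pos[OF k \<omega>] by (simp add: mult_nonpos_nonneg)
  then have X: "X (Suc k) \<omega> \<le> 0"
    using withdrawal_pos[of k \<omega>] by (simp add: fund_Suc del: fund.simps)
  then have "X (Suc k) \<omega> / A (Suc k) \<le> 0"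
    using hedge.base_pos[OF step.prems] by (simp add: divide_nonpos_pos del: fund.simps)
  then have "max (W k \<omega>) (X (Suc k) \<omega> / A (Suc k)) = W k \<omega>"
    using withdrawal_pos[of k \<omega>] by linarith
  then show ?case using X IH(2) by (simp del: fund.simps)
qed

lemma later_claims_Suc: "later_claims t \<omega> = Z (Suc t) \<omega> + later_claims (Suc t) \<omega>" if "t < N"
  using that unfolding later_claims_def by (subst sum.atLeast_Suc_atMost) auto

text \<open>The pathwise counterpart of \<open>payoff_step\<close>: the same case split, with the
  later claims in place of the time t + 1 hedge value.\<close>

lemma later_claims_step:
  assumes t: "t < N" and \<omega>: "\<omega> \<in> alive t"
  shows "later_claims t \<omega> = (if X (Suc t) \<omega> \<le> 0 then real (N - t - 1) * W t \<omega> - X (Suc t) \<omega>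
    else later_claims (Suc t) \<omega>)"
proof -
  have space: "\<omega> \<in> space M" using \<omega> by (simp add: alive_def)
  show ?thesis
  proof (cases "X (Suc t) \<omega> \<le> 0")
    case True
    then have dead: "\<omega> \<notin> alive (Suc t)" by (simp add: alive_Suc del: fund.simps)
    have "Z (Suc t) \<omega> = - X (Suc t) \<omega>"
      using True \<omega> dead by (simp add: claim_eq[OF t space] neg_part_def min_def del: fund.simps)
    moreover have "later_claims (Suc t) \<omega> = (\<Sum>u = Suc t + 1..N. W t \<omega>)"
      unfolding later_claims_def
    proof (rule sum.cong[OF refl])
      fix u assume u: "u \<in> {Suc t + 1..N}"
      define k where "k = u - 1"
      have k: "u = Suc k" "Suc t \<le> k" "k < N" using u by (auto simp: k_def)
      have "\<omega> \<notin> alive k"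
        using True k(2) by (auto simp: alive_def not_less simp del: fund.simps intro!: exI[of _ "Suc t"])
      then show "Z u \<omega> = W t \<omega>"
        using withdrawal_frozen[OF space True k(2,3)] space
        by (simp add: k(1) claim_eq[OF k(3) space] del: fund.simps)
    qed
    ultimately show ?thesis
      using True later_claims_Suc[OF t, of \<omega>] by (simp del: fund.simps)
  next
    case False
    then have "\<omega> \<in> alive (Suc t)" using \<omega> by (simp add: alive_Suc del: fund.simps)
    then have "Z (Suc t) \<omega> = 0" using \<omega> by (simp add: claim_eq[OF t space] del: fund.simps)
    with False show ?thesis
      using later_claims_Suc[OF t, of \<omega>] by (simp del: fund.simps)
  qed
qed

section \<open>Integrating the claims over events of the past\<close>

lemma payoff_process_measurable:
  "(\<lambda>(\<omega>, \<rho>). hedge.payoff t (W t \<omega>) (X t \<omega> * \<rho>)) \<in> borel_measurable (F t \<Otimes>\<^sub>M borel)" if "t < N"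
proof -
  have [measurable]: "X t \<in> borel_measurable (F t)" "W t \<in> borel_measurable (F t)"
    using that by (auto intro: fund_measurable withdrawal_measurable)
  note hedge.payoff_measurable[OF that, measurable]
  have "(\<lambda>x. (case (W t (fst x), X t (fst x) * snd x) of (w, v) \<Rightarrow> hedge.payoff t w v))
      \<in> borel_measurable (F t \<Otimes>\<^sub>M borel)"
    by measurable
  then show ?thesis by (simp add: case_prod_beta')
qed

lemma payoff_process_integrable:
  "integrable M (\<lambda>\<omega>. hedge.payoff t (W t \<omega>) (X t \<omega> * gross_return t \<omega>))" if t: "t < N"
proof -
  obtain C where C: "\<bar>hedge.payoff t w v\<bar> \<le> C * (\<bar>w\<bar> + \<bar>v\<bar>)" for w v
    using hedge.payoff_growth[OF t] by blast
  have int: "integrable M (X t)" "integrable M (W t)"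
    using t by (auto intro: fund_integrable withdrawal_integrable)
  note [measurable] = gross_return_measurable[OF t]
  have [measurable]: "X t \<in> borel_measurable M" "W t \<in> borel_measurable M"
    using int by auto
  show ?thesis
  proof (rule Bochner_Integration.integrable_bound)
    show "integrable M (\<lambda>\<omega>. C * (\<bar>W t \<omega>\<bar> + \<bar>X t \<omega> * gross_return t \<omega>\<bar>))"
      using int fund_times_return_integrable[OF t int(1)] by (intro integrable_mult_right Bochner_Integration.integrable_add integrable_abs)
    note hedge.payoff_measurable[OF t, measurable]
    have "(\<lambda>\<omega>. (case (W t \<omega>, X t \<omega> * gross_return t \<omega>) of (w, v) \<Rightarrow> hedge.payoff t w v))
        \<in> borel_measurable M"
      by measurable
    then show "(\<lambda>\<omega>. hedge.payoff t (W t \<omega>) (X t \<omega> * gross_return t \<omega>)) \<in> borel_measurable M"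
      by simp
    show "AE \<omega> in M. norm (hedge.payoff t (W t \<omega>) (X t \<omega> * gross_return t \<omega>))
        \<le> norm (C * (\<bar>W t \<omega>\<bar> + \<bar>X t \<omega> * gross_return t \<omega>\<bar>))"
      by (intro AE_I2) (use C in \<open>auto intro: order_trans[OF _ abs_ge_self]\<close>)
  qed
qed

text \<open>The restriction to subsets of \<open>alive t\<close> guarantees a positive fund, the
  domain on which the expected payoff is the hedge value.\<close>

lemma payoff_process_expectation:
  assumes t: "t < N" and B: "B \<in> sets (F t)" "B \<subseteq> alive t"
  shows "integrable M (\<lambda>\<omega>. indicator B \<omega> * hedge_value \<kappa> N r t (W t \<omega>) (X t \<omega>))"
    and "(\<integral>\<omega>. indicator B \<omega> * hedge.payoff t (W t \<omega>) (X t \<omega> * gross_return t \<omega>) \<partial>M)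
      = (\<integral>\<omega>. indicator B \<omega> * hedge_value \<kappa> N r t (W t \<omega>) (X t \<omega>) \<partial>M)"
proof -
  let ?h = "\<lambda>x. indicator B (fst x) * hedge.payoff t (W t (fst x)) (X t (fst x) * snd x)"
  have BM: "B \<in> sets M" using B(1) subalgebra_F[of t] t by (auto simp: subalgebra_def)
  note payoff_process_measurable[OF t, unfolded case_prod_beta', measurable] B(1) [measurable]
  have h: "?h \<in> borel_measurable (F t \<Otimes>\<^sub>M borel)" by measurable
  have int: "integrable M (\<lambda>\<omega>. ?h (\<omega>, gross_return t \<omega>))"
    using integrable_mult_indicator[OF BM payoff_process_integrable[OF t]] by simp
  have eq: "(\<integral>\<rho>. ?h (\<omega>, \<rho>) \<partial>\<kappa> t 1) = indicator B \<omega> * hedge_value \<kappa> N r t (W t \<omega>) (X t \<omega>)" for \<omega>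
  proof (cases "\<omega> \<in> B")
    case True
    then have "0 < X t \<omega>" using B(2) by (auto simp: alive_def)
    then show ?thesis
      using True hedge.payoff_expectation[OF t, of "X t \<omega>" "W t \<omega>"] by (simp add: has_bochner_integral_iff)
  qed simp
  show "integrable M (\<lambda>\<omega>. indicator B \<omega> * hedge_value \<kappa> N r t (W t \<omega>) (X t \<omega>))"
    using gross_return_integral(1)[OF t h int] unfolding eq .
  show "(\<integral>\<omega>. indicator B \<omega> * hedge.payoff t (W t \<omega>) (X t \<omega> * gross_return t \<omega>) \<partial>M)
      = (\<integral>\<omega>. indicator B \<omega> * hedge_value \<kappa> N r t (W t \<omega>) (X t \<omega>) \<partial>M)"
    using gross_return_integral(2)[OF t h int] unfolding eq by simp
qed

text \<open>The induction runs over integrals on F t-events instead of conditional expectations.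
  Enlarging the filtration is then mere inclusion of events, and no null sets accumulate over the
  dates.\<close>

lemma later_claims_set_integral:
  "t < N \<Longrightarrow> B \<in> sets (F t) \<Longrightarrow> B \<subseteq> alive t \<Longrightarrow>
    (\<integral>\<omega>. indicator B \<omega> * later_claims t \<omega> \<partial>M)
      = (\<integral>\<omega>. indicator B \<omega> * hedge_value \<kappa> N r t (W t \<omega>) (X t \<omega>) \<partial>M)"
proof (induction "N - t" arbitrary: t B)
  case (Suc n)
  have t: "t < N" by fact
  have "(\<integral>\<omega>. indicator B \<omega> * later_claims t \<omega> \<partial>M)
      = (\<integral>\<omega>. indicator B \<omega> * hedge.payoff t (W t \<omega>) (X t \<omega> * gross_return t \<omega>) \<partial>M)"
  proof (cases "t + 1 = N")
    case True
    have "indicator B \<omega> * later_claims t \<omega> = indicator B \<omega> * hedge.payoff t (W t \<omega>) (X t \<omega> * gross_return t \<omega>)" for \<omega>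
    proof (cases "\<omega> \<in> B")
      case \<omega>: True
      then have "\<omega> \<in> alive t" using Suc.prems by auto
      moreover have "later_claims (Suc t) \<omega> = 0" using True by (simp add: later_claims_def)
      ultimately have "later_claims t \<omega> = max 0 (- X (Suc t) \<omega>)"
        using True by (simp add: later_claims_step[OF t] del: fund.simps)
      then show ?thesis by (simp add: hedge.payoff_last[OF True] fund_Suc del: fund.simps)
    qed simp
    then show ?thesis by (simp only:)
  next
    case False
    then have t': "Suc t < N" using t by simp
    \<comment> \<open>The part of B that survives date t + 1. It belongs to
      \<open>F (Suc t)\<close>, so the induction hypothesis applies to it; on B - B' the later
      claims are explicit.\<close>
    define B' where "B' = B \<inter> alive (Suc t)"
    have alive': "alive (Suc t) \<in> sets (F (Suc t))" using t' by (intro alive_sets) simp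
    have BF: "B \<in> sets (F (Suc t))" using F_le[of t "Suc t"] t' Suc.prems by auto
    have B': "B' \<in> sets (F (Suc t))" "B' \<subseteq> alive (Suc t)"
      unfolding B'_def using BF alive' by auto
    have BM: "B \<in> sets M" "B' \<in> sets M"
      using BF B' subalgebra_F[of "Suc t"] t' by (auto simp: subalgebra_def)
    let ?dep = "\<lambda>\<omega>. indicator (B - B') \<omega> * (real (N - t - 1) * W t \<omega> - X (Suc t) \<omega>)"
    let ?V = "\<lambda>\<omega>. hedge_value \<kappa> N r (Suc t) (W (Suc t) \<omega>) (X (Suc t) \<omega>)"
    have int: "integrable M (\<lambda>\<omega>. indicator B' \<omega> * later_claims (Suc t) \<omega>)"
      using integrable_mult_indicator[OF BM(2) later_claims_integrable] by simp
    have intV: "integrable M (\<lambda>\<omega>. indicator B' \<omega> * ?V \<omega>)"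
      by (rule payoff_process_expectation(1)[OF t' B'])
    have int_dep: "integrable M ?dep"
    proof -
      have "integrable M (\<lambda>\<omega>. real (N - t - 1) * W t \<omega> - X (Suc t) \<omega>)"
        using t t' by (intro Bochner_Integration.integrable_diff integrable_mult_right withdrawal_integrable fund_integrable) auto
      moreover have "B - B' \<in> sets M" using BM by (rule sets.Diff)
      ultimately show ?thesis
        using integrable_mult_indicator by (simp only: real_scaleR_def[symmetric])
    qed
    have dep_iff: "\<omega> \<in> B' \<longleftrightarrow> 0 < X (Suc t) \<omega>" if "\<omega> \<in> B" for \<omega>
      using that Suc.prems by (auto simp: B'_def alive_Suc simp del: fund.simps)
    have "(\<integral>\<omega>. indicator B \<omega> * later_claims t \<omega> \<partial>M)
        = (\<integral>\<omega>. ?dep \<omega> + indicator B' \<omega> * later_claims (Suc t) \<omega> \<partial>M)"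
    proof (rule Bochner_Integration.integral_cong[OF refl])
      fix \<omega>
      show "indicator B \<omega> * later_claims t \<omega> = ?dep \<omega> + indicator B' \<omega> * later_claims (Suc t) \<omega>"
      proof (cases "\<omega> \<in> B")
        case True
        then have "\<omega> \<in> alive t" using Suc.prems by auto
        with True show ?thesis
          using dep_iff[OF True] by (auto simp: later_claims_step[OF t] split: split_indicator simp del: fund.simps)
      qed (simp add: B'_def)
    qed
    also have "\<dots> = (\<integral>\<omega>. ?dep \<omega> \<partial>M) + (\<integral>\<omega>. indicator B' \<omega> * later_claims (Suc t) \<omega> \<partial>M)"
      by (rule Bochner_Integration.integral_add[OF int_dep int])
    also have "(\<integral>\<omega>. indicator B' \<omega> * later_claims (Suc t) \<omega> \<partial>M) = (\<integral>\<omega>. indicator B' \<omega> * ?V \<omega> \<partial>M)"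
    proof (rule Suc.hyps(1)[OF _ t' B'])
      show "n = N - Suc t" using Suc.hyps(2) by arith
    qed
    also have "(\<integral>\<omega>. ?dep \<omega> \<partial>M) + (\<integral>\<omega>. indicator B' \<omega> * ?V \<omega> \<partial>M) = (\<integral>\<omega>. ?dep \<omega> + indicator B' \<omega> * ?V \<omega> \<partial>M)"
      by (rule Bochner_Integration.integral_add[OF int_dep intV, symmetric])
    \<comment> \<open>The depletion term on B - B' and the hedge value on B' are the two branches of
      \<open>payoff_step\<close>, the reset level being \<open>W (Suc t)\<close>.\<close>
    also have "\<dots> = (\<integral>\<omega>. indicator B \<omega> * hedge.payoff t (W t \<omega>) (X t \<omega> * gross_return t \<omega>) \<partial>M)"
    proof (rule Bochner_Integration.integral_cong[OF refl])
      fix \<omega>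
      show "?dep \<omega> + indicator B' \<omega> * ?V \<omega> = indicator B \<omega> * hedge.payoff t (W t \<omega>) (X t \<omega> * gross_return t \<omega>)"
      proof (cases "\<omega> \<in> B")
        case True
        have W: "W (Suc t) \<omega> = max (W t \<omega>) (X (Suc t) \<omega> / A (t + 1))" by simp
        have "hedge.payoff t (W t \<omega>) (X t \<omega> * gross_return t \<omega>)
            = (if X (Suc t) \<omega> \<le> 0 then real (N - t - 1) * W t \<omega> - X (Suc t) \<omega> else ?V \<omega>)"
          unfolding W using t' by (subst hedge.payoff_step) (simp_all add: withdrawal_pos fund_Suc del: fund.simps)
        with True show ?thesis
          using dep_iff[OF True] by (auto split: split_indicator simp del: fund.simps withdrawal.simps)
      qed (simp add: B'_def)
    qed
    finally show ?thesis .
  qed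
  also have "\<dots> = (\<integral>\<omega>. indicator B \<omega> * hedge_value \<kappa> N r t (W t \<omega>) (X t \<omega>) \<partial>M)"
    by (rule payoff_process_expectation(2)[OF t Suc.prems(2,3)])
  finally show ?case .
qed simp

lemma later_claims_value_eq_hedge_value:
  assumes t: "t < N"
  shows "AE \<omega> in M. enat t < \<tau> \<omega> \<longrightarrow>
    later_claims_value M F N r x\<^sub>0 w\<^sub>0 S t \<omega> = hedge_value \<kappa> N r t (W t \<omega>) (X t \<omega>)"
proof -
  interpret sigma_finite_subalgebra M "F t" using t by (intro sigma_finite_F) simp
  interpret R: real_distribution "\<kappa> t 1" by (rule kernel_distribution[OF t]) simp
  have E: "alive t \<in> sets (F t)" and EM: "alive t \<in> sets M"
    using t by (auto intro: alive_sets alive_sets_M)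
  let ?V = "\<lambda>\<omega>. indicator (alive t) \<omega> * hedge_value \<kappa> N r t (W t \<omega>) (X t \<omega>)"
  \<comment> \<open>On \<open>alive t\<close> the hedge value is the integral over returns of the
    jointly measurable payoff, and this yields its measurability in F t.\<close>
  have V_measurable: "?V \<in> borel_measurable (F t)"
  proof -
    note payoff_process_measurable[OF t, unfolded case_prod_beta', measurable] E [measurable]
    have "(\<lambda>\<omega>. indicator (alive t) \<omega> * (\<integral>\<rho>. hedge.payoff t (W t \<omega>) (X t \<omega> * \<rho>) \<partial>\<kappa> t 1))
        \<in> borel_measurable (F t)"
      by measurable
    moreover have "indicator (alive t) \<omega> * (\<integral>\<rho>. hedge.payoff t (W t \<omega>) (X t \<omega> * \<rho>) \<partial>\<kappa> t 1) = ?V \<omega>" for \<omega>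
      using hedge.payoff_expectation[OF t, of "X t \<omega>" "W t \<omega>"]
      by (auto simp: has_bochner_integral_iff alive_def split: split_indicator)
    ultimately show ?thesis by simp
  qed
  have int: "integrable M (\<lambda>\<omega>. indicator (alive t) \<omega> * later_claims t \<omega>)"
    using integrable_mult_indicator[OF EM later_claims_integrable] by simp
  have "AE \<omega> in M. real_cond_exp M (F t) (\<lambda>\<omega>. indicator (alive t) \<omega> * later_claims t \<omega>) \<omega> = ?V \<omega>"
  proof (rule real_cond_exp_charact)
    fix B assume B: "B \<in> sets (F t)"
    have "(\<integral>\<omega>. indicator (B \<inter> alive t) \<omega> * later_claims t \<omega> \<partial>M)
        = (\<integral>\<omega>. indicator (B \<inter> alive t) \<omega> * hedge_value \<kappa> N r t (W t \<omega>) (X t \<omega>) \<partial>M)"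
      using B E by (intro later_claims_set_integral t) auto
    then show "(\<integral>\<omega>\<in>B. (indicator (alive t) \<omega> * later_claims t \<omega>) \<partial>M) = (\<integral>\<omega>\<in>B. ?V \<omega> \<partial>M)"
      by (simp add: set_lebesgue_integral_def indicator_inter_arith mult.assoc)
  qed (use int V_measurable payoff_process_expectation(1)[OF t E] in auto)
  \<comment> \<open>Since \<open>alive t\<close> lies in F t, its indicator can be taken out, which
    recovers the conditional expectation of the claims on that event.\<close>
  moreover have "AE \<omega> in M. real_cond_exp M (F t) (\<lambda>\<omega>. indicator (alive t) \<omega> * later_claims t \<omega>) \<omega>
      = indicator (alive t) \<omega> * real_cond_exp M (F t) (later_claims t) \<omega>"
    using E int later_claims_integrable[of t] by (intro real_cond_exp_mult) auto
  ultimately show ?thesis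
    using AE_space
  proof eventually_elim
    case (elim \<omega>)
    show ?case
    proof
      assume "enat t < \<tau> \<omega>"
      then have "\<omega> \<in> alive t" using t elim(3) by (simp add: alive_iff)
      with elim(1,2) show "later_claims_value M F N r x\<^sub>0 w\<^sub>0 S t \<omega> = hedge_value \<kappa> N r t (W t \<omega>) (X t \<omega>)"
        by (simp add: later_claims_value_def later_claims_def[abs_def])
    qed
  qed
qed

end

theorem mainTheorem5:
  fixes M :: "'a measure" and F :: "nat \<Rightarrow> 'a measure" and S :: "nat \<Rightarrow> 'a \<Rightarrow> real"
    and \<kappa> :: "nat \<Rightarrow> real \<Rightarrow> real measure" and N :: nat and r x\<^sub>0 w\<^sub>0 :: real
  assumes "prob_space M"
    and "filtration_upto M F N"
    and "martingale_upto M F S N"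
    and "\<And>t \<omega>. t \<le> N \<Longrightarrow> \<omega> \<in> space M \<Longrightarrow> 0 < S t \<omega>"
    and "\<And>\<omega>. \<omega> \<in> space M \<Longrightarrow> S 0 \<omega> = 1"
    and "assumption_A1 M F S \<kappa> N"
    and "assumption_A2 \<kappa> N"
    and "2 \<le> N"
    and "- 1 < r"
    and "0 < x\<^sub>0"
    and "0 < w\<^sub>0"
  shows "\<forall>t<N.
    (AE \<omega> in M. enat t < depletion_time N r x\<^sub>0 w\<^sub>0 S \<omega> \<longrightarrow>
       later_claims_value M F N r x\<^sub>0 w\<^sub>0 S t \<omega> =
       hedge_value \<kappa> N r t (withdrawal N r x\<^sub>0 w\<^sub>0 S t \<omega>) (fund N r x\<^sub>0 w\<^sub>0 S t \<omega>)) \<and>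
    (\<forall>s w x. 0 < s \<longrightarrow> 0 < w \<longrightarrow> 0 < x \<longrightarrow>
       kernel_value \<kappa> N r t s w x = hedge_value \<kappa> N r t w x)"
proof -
  interpret prob_space M by fact
  interpret guarantee M F S \<kappa> N r x\<^sub>0 w\<^sub>0
    using assms by unfold_locales auto
  show ?thesis
    using later_claims_value_eq_hedge_value hedge.kernel_value_eq_hedge_value by blast
qed

end
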